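(* Let $J_0$ be a real symmetric $2$-periodic Jacobi matrix with $\sigma_c(J_0)=[-d,-s]\cup[s,d]$, $0<s<d$, and let $J$ be a complex Jacobi matrix that is a compact perturbation of $J_0$, with $d_m$, $u$, $w$, $\nu$, $\varepsilon$ as defined in the context. Assume $\sum_{m=1}^\infty d_m<\infty$. Let $t\simeq 0.567$ be the unique positive root of $x e^{x}=1$ and let $$K_2(s,d)=\frac{1024\sqrt 2\,d^5}{(d-s)^5\,(d^2-s^2)^{1/2}}.$$ Then in the domain of $\lambda\in\mathbb{C}$ defined by $$\frac{K_2(s,d)\,|w(\lambda)|}{|w^2(\lambda)-w^{2\varepsilon}(\nu)|\,|1-w^4(\lambda)|}\sum_{m=1}^\infty d_m<t$$ the operator $J$ has no discrete spectrum.
   Context: Matrices. $J_0$ is the semi-infinite tridiagonal matrix acting on $\ell^2(\mathbb{N})$, $\mathbb{N}=\{1,2,\dots\}$, by $(J_0y)_n=a^0_{n-1}y_{n-1}+b^0_ny_n+a^0_ny_{n+1}$ (with $y_0=0$), where $a^0_{n+2}=a^0_n>0$, $b^0_{n+2}=b^0_n\in\mathbb{R}$, and $a^0_0:=a^0_2$. Its continuous spectrum $\sigma_c(J_0)$ is $[-d,-s]\cup[s,d]$ with $0<s<d$ (a normalization obtained by shifting the spectral parameter; it forces $b_2^0=-b_1^0$). $J$ is the complex Jacobi matrix $(Jy)_n=a_{n-1}y_{n-1}+b_ny_n+c_ny_{n+1}$ (with $y_0=0$) with $a_n,b_n,c_n\in\mathbb{C}$, $a_nc_n\neq0$ for $n\ge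 1$, such that $J-J_0$ is compact on $\ell^2(\mathbb{N})$. Perturbation size. $d_m:=|b^0_m-b_m|+\left|a^0_{m-1}-\dfrac{a_{m-1}c_{m-1}}{a^0_{m-1}}\right|$ for $m\ge1$, with the convention $a_0=c_0=a_0^0$ (so $d_1=|b^0_1-b_1|$). The number $\nu:=b_1^0$ satisfies $-s\le\nu\le s$. Put $\varepsilon=1$ if $J_0$ has an eigenvalue in $(-s,s)$ (this eigenvalue is then $\nu$), and $\varepsilon=-1$ otherwise. Floquet multiplier. Let $u(\lambda)=\frac{2}{d^2-s^2}\left(\lambda^2-\frac{d^2+s^2}{2}\right)$; then $\sigma_c(J_0)=\{\lambda: -1\le u(\lambda)\le1\}$. For $\lambda\in\mathbb{C}\setminus\sigma_c(J_0)$, $w^2(\lambda)$ is the unique root $\zeta$ with $|\zeta|<1$ of $\zeta+\zeta^{-1}=2u(\lambda)$; for $\lambda\in\sigma_c(J_0)$ boundary values are taken, and then $|w|=1$ (both boundary values give the same moduli in the inequality). Write $|w|=|w^2|^{1/2}$, $w^4=(w^2)^2$, $w^{2\varepsilon}(\nu)=(w^2(\nu))^{\varepsilon}$ (and $w^2(\nu)=-1$ if $\nu=\pm s$). Where the denominator in the inequality vanishes the inequality is regarded as not satisfied. The discrete spectrum of $J$ is the set of eigenvalues of $J$ in $\mathbb{C}\setminus\sigma_c(J_0)$. *)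

theory Defs
  imports "HOL-Analysis.Analysis"
begin

text \<open>
  The Hilbert space of square-summable sequences indexed by \<open>1, 2, \<dots>\<close>. Elements are
  functions on \<open>nat\<close> whose value at \<open>0\<close> is \<open>0\<close>, so that the boundary
  convention \<open>y\<^sub>0 = 0\<close> of the Jacobi matrices is part of the type.
\<close>

typedef ell2 = "{y :: nat \<Rightarrow> complex. y 0 = 0 \<and> summable (\<lambda>n. (cmod (y n))\<^sup>2)}"
  morphisms coord Abs_ell2
  by (rule exI[of _ "\<lambda>_. 0"]) simp

setup_lifting type_definition_ell2

lemma ell2_summable_add:
  fixes x y :: "nat \<Rightarrow> complex"
  assumes "summable (\<lambda>n. (cmod (x n))\<^sup>2)" "summable (\<lambda>n. (cmod (y n))\<^sup>2)"
  shows "summable (\<lambda>n. (cmod (x n + y n))\<^sup>2)"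
proof (rule summable_comparison_test')
  show "summable (\<lambda>n. 2 * (cmod (x n))\<^sup>2 + 2 * (cmod (y n))\<^sup>2)"
    using assms by (intro summable_add summable_mult)
  show "norm ((cmod (x n + y n))\<^sup>2) \<le> 2 * (cmod (x n))\<^sup>2 + 2 * (cmod (y n))\<^sup>2" if "n \<ge> 0" for n
  proof -
    have "(cmod (x n + y n))\<^sup>2 \<le> (cmod (x n) + cmod (y n))\<^sup>2"
      by (intro power_mono norm_triangle_ineq) auto
    also have "\<dots> \<le> 2 * (cmod (x n))\<^sup>2 + 2 * (cmod (y n))\<^sup>2"
      using sum_squares_bound[of "cmod (x n)" "cmod (y n)"] by (simp add: power2_sum)
    finally show ?thesis by simp
  qed
qed

lemma ell2_summable_mult:
  fixes x :: "nat \<Rightarrow> complex"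
  assumes "summable (\<lambda>n. (cmod (x n))\<^sup>2)"
  shows "summable (\<lambda>n. (cmod (k * x n))\<^sup>2)"
  using summable_mult[OF assms, of "(cmod k)\<^sup>2"] by (simp add: norm_mult power_mult_distrib)

lemma ell2_summable_inner:
  fixes x y :: "nat \<Rightarrow> complex"
  assumes "summable (\<lambda>n. (cmod (x n))\<^sup>2)" "summable (\<lambda>n. (cmod (y n))\<^sup>2)"
  shows "summable (\<lambda>n. x n \<bullet> y n)"
proof (rule summable_comparison_test')
  show "summable (\<lambda>n. (cmod (x n))\<^sup>2 + (cmod (y n))\<^sup>2)"
    using assms by (rule summable_add)
  show "norm (x n \<bullet> y n) \<le> (cmod (x n))\<^sup>2 + (cmod (y n))\<^sup>2" if "n \<ge> 0" for n
  proof -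
    have "\<bar>x n \<bullet> y n\<bar> \<le> cmod (x n) * cmod (y n)" by (rule Cauchy_Schwarz_ineq2)
    also have "\<dots> \<le> 2 * cmod (x n) * cmod (y n)" by simp
    also have "\<dots> \<le> (cmod (x n))\<^sup>2 + (cmod (y n))\<^sup>2" by (rule sum_squares_bound)
    finally show ?thesis by simp
  qed
qed

text \<open>
  The real inner product \<open>x \<bullet> y\<close> is the real part of the Hermitian one; it induces the
  usual norm, whose square is the sum of the squared moduli of the entries.
\<close>

instantiation ell2 :: real_inner
begin

lift_definition zero_ell2 :: ell2 is "\<lambda>_. 0" by simp
lift_definition plus_ell2 :: "ell2 \<Rightarrow> ell2 \<Rightarrow> ell2" is "\<lambda>x y n. x n + y n"
  by (simp add: ell2_summable_add)
lift_definition uminus_ell2 :: "ell2 \<Rightarrow> ell2" is "\<lambda>x n. - x n" by simp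
definition minus_ell2 :: "ell2 \<Rightarrow> ell2 \<Rightarrow> ell2" where "x - y = x + (- y)" for x y :: ell2
lift_definition scaleR_ell2 :: "real \<Rightarrow> ell2 \<Rightarrow> ell2" is "\<lambda>r x n. of_real r * x n"
  by (intro conjI ell2_summable_mult) auto
lift_definition inner_ell2 :: "ell2 \<Rightarrow> ell2 \<Rightarrow> real" is "\<lambda>x y. \<Sum>n. x n \<bullet> y n" .
definition norm_ell2 :: "ell2 \<Rightarrow> real" where "norm_ell2 x = sqrt (x \<bullet> x)"
definition sgn_ell2 :: "ell2 \<Rightarrow> ell2" where "sgn_ell2 x = inverse (norm x) *\<^sub>R x"
definition dist_ell2 :: "ell2 \<Rightarrow> ell2 \<Rightarrow> real" where "dist_ell2 x y = norm (x - y)"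
definition uniformity_ell2 :: "(ell2 \<times> ell2) filter" where
  "uniformity_ell2 = (INF e\<in>{0<..}. principal {(x, y). dist x y < e})"
definition open_ell2 :: "ell2 set \<Rightarrow> bool" where
  "open_ell2 U = (\<forall>x\<in>U. \<forall>\<^sub>F (x', y) in uniformity. x' = x \<longrightarrow> y \<in> U)"

instance
proof
  fix x y z :: ell2 and r q :: real
  show "x + y + z = x + (y + z)" by transfer (simp add: add.assoc)
  show "x + y = y + x" by transfer (simp add: add.commute)
  show "0 + x = x" by transfer simp
  show "- x + x = 0" by transfer simp
  show "x - y = x + - y" by (rule minus_ell2_def)
  show "r *\<^sub>R (x + y) = r *\<^sub>R x + r *\<^sub>R y" by transfer (simp add: distrib_left)
  show "(r + q) *\<^sub>R x = r *\<^sub>R x + q *\<^sub>R x" by transfer (simp add: distrib_right)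
  show "r *\<^sub>R q *\<^sub>R x = (r * q) *\<^sub>R x" by transfer (simp add: mult.assoc)
  show "1 *\<^sub>R x = x" by transfer simp
  show "dist x y = norm (x - y)" by (rule dist_ell2_def)
  show "sgn x = inverse (norm x) *\<^sub>R x" by (rule sgn_ell2_def)
  show "uniformity = (INF e\<in>{0<..}. principal {(x :: ell2, y). dist x y < e})"
    by (rule uniformity_ell2_def)
  show "open U = (\<forall>x\<in>U. \<forall>\<^sub>F (x', y) in uniformity. x' = x \<longrightarrow> y \<in> U)" for U :: "ell2 set"
    by (rule open_ell2_def)
  show "x \<bullet> y = y \<bullet> x" by transfer (simp add: inner_commute)
  show "(x + y) \<bullet> z = x \<bullet> z + y \<bullet> z"
    by transfer (simp add: inner_add_left suminf_add ell2_summable_inner)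
  show "r *\<^sub>R x \<bullet> y = r * (x \<bullet> y)"
    by transfer (simp add: suminf_mult ell2_summable_inner flip: scaleR_conv_of_real)
  show "0 \<le> x \<bullet> x"
    by transfer (simp add: suminf_nonneg ell2_summable_inner)
  show "x \<bullet> x = 0 \<longleftrightarrow> x = 0"
    by transfer (auto simp: suminf_eq_zero_iff ell2_summable_inner)
  show "norm x = sqrt (x \<bullet> x)" by (rule norm_ell2_def)
qed

end

lift_definition scaleC :: "complex \<Rightarrow> ell2 \<Rightarrow> ell2" (infixr "*\<^sub>C" 75) is "\<lambda>k x n. k * x n"
  by (simp add: ell2_summable_mult)

definition compact_operator :: "('a::real_normed_vector \<Rightarrow> 'b::real_normed_vector) \<Rightarrow> bool" where
  "compact_operator T \<longleftrightarrow> bounded_linear T \<and> (\<forall>S. bounded S \<longrightarrow> compact (closure (T ` S)))"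

definition is_eigenvalue :: "(ell2 \<Rightarrow> ell2) \<Rightarrow> complex \<Rightarrow> bool" where
  "is_eigenvalue T z \<longleftrightarrow> (\<exists>y. y \<noteq> 0 \<and> T y = z *\<^sub>C y)"

text \<open>
  The part of the spectrum where \<open>T - z\<close> is injective with dense range but not onto. For
  the periodic matrices considered here it agrees with the spectrum of the restriction to
  the orthogonal complement of the eigenvectors.
\<close>

definition continuous_spectrum :: "(ell2 \<Rightarrow> ell2) \<Rightarrow> complex set" where
  "continuous_spectrum T =
    {z. inj (\<lambda>y. T y - z *\<^sub>C y) \<and> closure (range (\<lambda>y. T y - z *\<^sub>C y)) = UNIV
        \<and> \<not> surj (\<lambda>y. T y - z *\<^sub>C y)}"

definition discrete_spectrum :: "(ell2 \<Rightarrow> ell2) \<Rightarrow> (ell2 \<Rightarrow> ell2) \<Rightarrow> complex set" where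
  "discrete_spectrum J J0 = {z. is_eigenvalue J z} - continuous_spectrum J0"

text \<open>
  \<open>T\<close> is the everywhere defined operator with the tridiagonal matrix having subdiagonal
  \<open>a\<close>, diagonal \<open>b\<close> and superdiagonal \<open>c\<close>. The value \<open>a 0\<close> is irrelevant here, as
  \<open>coord y 0 = 0\<close>.
\<close>

definition jacobi_operator ::
    "(nat \<Rightarrow> complex) \<Rightarrow> (nat \<Rightarrow> complex) \<Rightarrow> (nat \<Rightarrow> complex) \<Rightarrow> (ell2 \<Rightarrow> ell2) \<Rightarrow> bool" where
  "jacobi_operator a b c T \<longleftrightarrow>
    (\<forall>y. \<forall>n\<ge>1. coord (T y) n = a (n - 1) * coord y (n - 1) + b n * coord y n + c n * coord y (n + 1))"

definition perturbation_size ::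
    "(nat \<Rightarrow> real) \<Rightarrow> (nat \<Rightarrow> real) \<Rightarrow> (nat \<Rightarrow> complex) \<Rightarrow> (nat \<Rightarrow> complex) \<Rightarrow> (nat \<Rightarrow> complex)
      \<Rightarrow> nat \<Rightarrow> real" where
  "perturbation_size a0 b0 a b c m =
    cmod (complex_of_real (b0 m) - b m)
    + cmod (complex_of_real (a0 (m - 1)) - a (m - 1) * c (m - 1) / complex_of_real (a0 (m - 1)))"

text \<open>
  With \<open>bands s d\<close> the continuous spectrum of the periodic matrix, it is also the set where
  \<open>floquet_u s d\<close> takes values in \<open>[-1, 1]\<close>.
\<close>

definition bands :: "real \<Rightarrow> real \<Rightarrow> complex set" where
  "bands s d = complex_of_real ` ({-d..-s} \<union> {s..d})"

definition floquet_u :: "real \<Rightarrow> real \<Rightarrow> complex \<Rightarrow> complex" where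
  "floquet_u s d z =
    2 / complex_of_real (d\<^sup>2 - s\<^sup>2) * (z\<^sup>2 - complex_of_real ((d\<^sup>2 + s\<^sup>2) / 2))"

definition small_root :: "real \<Rightarrow> real \<Rightarrow> complex \<Rightarrow> complex" where
  "small_root s d z =
    (THE \<zeta>. \<zeta> \<noteq> 0 \<and> cmod \<zeta> < 1 \<and> \<zeta> + inverse \<zeta> = 2 * floquet_u s d z)"

text \<open>
  The function \<open>w\<^sup>2\<close>. On the bands the boundary value from the upper half-plane is taken.
  The one from the lower half-plane is its complex conjugate, and the moduli
  \<open>|w\<^sup>2 - r|\<close> (\<open>r\<close> real) and \<open>|1 - w\<^sup>4|\<close> are the same for both.
\<close>

definition w_sq :: "real \<Rightarrow> real \<Rightarrow> complex \<Rightarrow> complex" where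
  "w_sq s d z =
    (if z \<in> bands s d then Lim (at z within {\<mu>. Im \<mu> > 0}) (small_root s d)
     else small_root s d z)"

definition epsilon :: "(ell2 \<Rightarrow> ell2) \<Rightarrow> real \<Rightarrow> int" where
  "epsilon J0 s =
    (if \<exists>x\<in>{-s<..<s}. is_eigenvalue J0 (complex_of_real x) then 1 else -1)"

definition K2 :: "real \<Rightarrow> real \<Rightarrow> real" where
  "K2 s d = 1024 * sqrt 2 * d ^ 5 / ((d - s) ^ 5 * sqrt (d\<^sup>2 - s\<^sup>2))"

end

theory Submission
  imports Defs
begin

text \<open>
  Write \<open>\<alpha> = a\<^sub>1\<close>, \<open>\<beta> = a\<^sub>2\<close> for the unperturbed off-diagonal entries, and let \<open>\<zeta> = w\<^sup>2\<close>.
  Outside the bands the Green function of \<open>J\<^sub>0\<close> is a product of the Dirichlet and the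
  decaying Floquet solution, divided by a Wronskian proportional to \<open>\<zeta> + \<alpha> / \<beta>\<close>; explicit formulas
  bound its \<open>(n, m)\<close> entry by \<open>K\<^sub>2 |w| / (|\<zeta> + \<alpha> / \<beta>| |1 - \<zeta>\<^sup>2|)\<close> times the power \<open>|n - m|\<close> of \<open>|w|\<close>.
  A diagonal gauge transformation turns an eigenvector of \<open>J\<close> into a solution of the \<open>J\<^sub>0\<close>
  recurrence with right-hand side controlled by \<open>d\<^sub>m\<close>. The gauge factors grow at most
  subexponentially, by compactness of \<open>J - J\<^sub>0\<close>, so the Green function still represents this
  solution, and a contraction estimate in a slightly weighted supremum norm forces it to vanish
  once the total mass is below \<open>1\<close>, in particular below \<open>t < 1\<close>.

  The identity \<open>w\<^sup>2\<^sup>\<epsilon>(\<nu>) = - \<alpha> / \<beta>\<close> and the relations between the entries of \<open>J\<^sub>0\<close> and \<open>s, d\<close>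
  come from the continuous spectrum, which up to finitely many points is found by discriminating
  oscillating from exponentially growing or decaying solutions.
\<close>

section \<open>Sequences and operators on square-summable sequences\<close>

text \<open>The numbers s and d enter only through the continuous spectrum, so the relations r = -p,
  d^2 = p^2 + (\<alpha> + \<beta>)^2 and s^2 = p^2 + (\<alpha> - \<beta>)^2, with p = \<nu> and r
  the diagonal entries, have to be extracted from it. The multiplier equation factors as (z - p) (z
  - r) \<zeta> = (\<alpha> + \<beta> \<zeta>) (\<beta> + \<alpha> \<zeta>). Hence the Wronskian can
  vanish only at p or r. At p the two roots are -\<alpha>/\<beta> and -\<beta>/\<alpha>; the first
  is the small one exactly if \<alpha> < \<beta>, which is also when p is an eigenvalue in the gap,
  so the exponent \<epsilon> always restores -\<alpha>/\<beta>. The same factorization, with r = -p,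
  gives |z| |w| \<le> d and makes the Green function estimate uniform in z. The constant that comes
  out is 4 d^2 / (\<alpha> \<beta>^2); the constant of the theorem dominates it because \<alpha>
  \<beta> = (d^2 - s^2) / 4 and \<beta> \<ge> (d - s) / 2. The obstacle to a plain contraction is
  that the gauged eigenvector is not known to be bounded: its supremum becomes finite only after
  weighting by q^n with |w| < q < 1.\<close>

lemma coord_0 [simp]: "coord y 0 = 0"
  using coord[of y] by auto

lemma summable_coord: "summable (\<lambda>n. (cmod (coord y n))\<^sup>2)"
  using coord[of y] by auto

lemma coord_zero [simp]: "coord 0 n = 0"
  by transfer simp

lemma coord_add [simp]: "coord (x + y) n = coord x n + coord y n"
  by transfer simp

lemma coord_minus [simp]: "coord (x - y) n = coord x n - coord y n"
  unfolding minus_ell2_def by transfer simp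

lemma coord_scaleC [simp]: "coord (k *\<^sub>C x) n = k * coord x n"
  by transfer simp

lemma coord_scaleR [simp]: "coord (r *\<^sub>R x) n = of_real r * coord x n"
  by transfer simp

lemma ell2_eqI: "(\<And>n. n \<ge> 1 \<Longrightarrow> coord x n = coord y n) \<Longrightarrow> x = y"
  by (subst coord_inject[symmetric], rule ext) (metis coord_0 less_one not_less)

lemma norm_ell2_sq: "(norm x)\<^sup>2 = (\<Sum>n. (cmod (coord x n))\<^sup>2)"
proof -
  have "(norm x)\<^sup>2 = x \<bullet> x"
    by (simp add: power2_norm_eq_inner)
  also have "\<dots> = (\<Sum>n. (cmod (coord x n))\<^sup>2)"
    by (simp add: inner_ell2.rep_eq power2_norm_eq_inner)
  finally show ?thesis .
qed

lemma cmod_coord_le_norm: "cmod (coord x n) \<le> norm x"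
proof (rule power2_le_imp_le)
  show "(cmod (coord x n))\<^sup>2 \<le> (norm x)\<^sup>2"
    unfolding norm_ell2_sq
    using sum_le_suminf[OF summable_coord, of "{n}" x] by simp
qed simp

lemma norm_scaleC: "norm (k *\<^sub>C x) = cmod k * norm x"
proof -
  have "(norm (k *\<^sub>C x))\<^sup>2 = (cmod k * norm x)\<^sup>2"
    by (simp add: norm_ell2_sq norm_mult power_mult_distrib suminf_mult summable_coord)
  thus ?thesis by simp
qed

lemma bounded_linear_coord: "bounded_linear (\<lambda>x. coord x n)"
  by (rule bounded_linear_intro[where K = 1]) (auto simp: cmod_coord_le_norm scaleR_conv_of_real)

lemma bounded_linear_scaleC: "bounded_linear (\<lambda>x. k *\<^sub>C x)"
  by (rule bounded_linear_intro[where K = "cmod k"])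
    (auto intro!: ell2_eqI simp: algebra_simps norm_scaleC)

lemma coord_tendsto_0: "coord y \<longlonglongrightarrow> 0"
proof -
  have "(\<lambda>n. sqrt ((cmod (coord y n))\<^sup>2)) \<longlonglongrightarrow> sqrt 0"
    by (intro tendsto_real_sqrt summable_LIMSEQ_zero summable_coord)
  thus ?thesis by (simp add: tendsto_norm_zero_iff)
qed

lift_definition unit_vec :: "nat \<Rightarrow> ell2" is "\<lambda>n k. if k = n \<and> k \<noteq> 0 then 1 else 0"
proof (intro conjI)
  fix n :: nat
  show "summable (\<lambda>k. (cmod (if k = n \<and> k \<noteq> 0 then 1 else 0))\<^sup>2)"
    by (rule summable_finite[of "{n}"]) auto
qed auto

lemma coord_unit_vec: "coord (unit_vec n) k = (if k = n \<and> k \<noteq> 0 then 1 else 0)"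
  by transfer simp

lemma norm_unit_vec_le: "norm (unit_vec n) \<le> 1"
proof (rule power2_le_imp_le)
  have "(norm (unit_vec n))\<^sup>2 = (\<Sum>k\<in>{n}. (cmod (coord (unit_vec n) k))\<^sup>2)"
    unfolding norm_ell2_sq by (rule suminf_finite) (auto simp: coord_unit_vec)
  also have "\<dots> \<le> 1\<^sup>2" by (simp add: coord_unit_vec)
  finally show "(norm (unit_vec n))\<^sup>2 \<le> 1\<^sup>2" .
qed simp

text \<open>A compact operator maps the weakly null sequence of unit vectors to a norm null
  sequence. Weak convergence is replaced by hand: a limit point of the images has all coordinates 0,
  while a fixed entry size e would keep the norms above e.\<close>

lemma compact_jacobi_difference:
  assumes J0: "jacobi_operator a0 b0 c0 J0" and J: "jacobi_operator a b c J"
    and K: "compact_operator (\<lambda>y. J y - J0 y)"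
  shows "(\<lambda>n. c n - c0 n) \<longlonglongrightarrow> 0"
proof (rule ccontr)
  define T where "T = (\<lambda>y. J y - J0 y)"
  have T: "coord (T (unit_vec (Suc n))) k =
      (if k = n then c n - c0 n else if k = Suc n then b k - b0 k
       else if k = Suc (Suc n) then a (Suc n) - a0 (Suc n) else 0)" if "n \<ge> 1" for n k
    using that J0 J unfolding T_def jacobi_operator_def
    by (cases "k = 0") (auto simp: coord_unit_vec)
  assume "\<not> (\<lambda>n. c n - c0 n) \<longlonglongrightarrow> 0"
  then obtain e where e: "e > 0" "\<forall>N. \<exists>n\<ge>N. cmod (c n - c0 n) \<ge> e"
    by (auto simp: lim_sequentially not_less)
  hence "\<forall>N. \<exists>n>N. cmod (c n - c0 n) \<ge> e"
    by (metis Suc_le_eq)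
  then obtain r :: "nat \<Rightarrow> nat" where r: "strict_mono r" "\<And>j. cmod (c (r j) - c0 (r j)) \<ge> e"
  proof -
    have "infinite {n. cmod (c n - c0 n) \<ge> e}"
      using \<open>\<forall>N. \<exists>n>N. cmod (c n - c0 n) \<ge> e\<close> by (auto simp: infinite_nat_iff_unbounded)
    from infinite_enumerate[OF this] show ?thesis using that by auto
  qed
  \<comment> \<open>\<open>r 0\<close> may be 0, which is no matrix row; shifting to
    \<open>r (Suc j)\<close> guarantees a row index of at least 1. The entry
    \<open>c n - c0 n\<close> sits in row n of column n + 1.\<close>
  define x where "x = (\<lambda>j. T (unit_vec (Suc (r (Suc j)))))"
  have r1: "r (Suc j) > j" for j
    using strict_mono_imp_increasing[OF r(1), of "Suc j"] by simp
  have "bounded (range unit_vec)"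
    unfolding bounded_iff using norm_unit_vec_le by auto
  hence "compact (closure (T ` range unit_vec))"
    using K unfolding compact_operator_def T_def by blast
  moreover have "\<forall>j. x j \<in> closure (T ` range unit_vec)"
    unfolding x_def by (intro allI subsetD[OF closure_subset] imageI rangeI)
  ultimately obtain l and q :: "nat \<Rightarrow> nat" where q: "strict_mono q" "(x \<circ> q) \<longlonglongrightarrow> l"
    unfolding compact_def by metis
  have "coord l k = 0" for k
  proof -
    have "(\<lambda>j. coord ((x \<circ> q) j) k) \<longlonglongrightarrow> coord l k"
      by (rule bounded_linear.tendsto[OF bounded_linear_coord q(2)])
    moreover have "\<forall>\<^sub>F j in sequentially. coord ((x \<circ> q) j) k = 0"
    proof (rule eventually_sequentiallyI)
      fix j assume "k \<le> j"
      hence "k < r (Suc (q j))"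
        using r1[of "q j"] strict_mono_imp_increasing[OF q(1), of j] by linarith
      thus "coord ((x \<circ> q) j) k = 0"
        unfolding x_def comp_def by (subst T) auto
    qed
    ultimately show ?thesis
      by (rule LIMSEQ_unique[OF _ tendsto_eventually])
  qed
  hence "l = 0" by (intro ell2_eqI) simp
  hence "(\<lambda>j. norm ((x \<circ> q) j)) \<longlonglongrightarrow> 0"
    using tendsto_norm[OF q(2)] by simp
  moreover have "norm ((x \<circ> q) j) \<ge> e" for j
  proof -
    have "e \<le> cmod (coord (x (q j)) (r (Suc (q j))))"
      unfolding x_def using r(2)[of "Suc (q j)"] r1[of "q j"] by (subst T) auto
    also have "\<dots> \<le> norm (x (q j))" by (rule cmod_coord_le_norm)
    finally show ?thesis by simp
  qed
  ultimately have "e \<le> 0"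
    by (intro LIMSEQ_le_const[of _ 0 e]) auto
  thus False using e by simp
qed

text \<open>The closure of the range is a closed complex subspace. Column m of the matrix expresses
  the unit vector m + 1 through its two predecessors and an element of the range, as the subdiagonal
  entry is nonzero; so the first unit vector generates all of them.\<close>

lemma dense_range_if_unit_vec_1:
  fixes z :: complex and a b c :: "nat \<Rightarrow> complex"
  assumes T: "jacobi_operator a b c T" and a: "\<And>n. n \<ge> 1 \<Longrightarrow> a n \<noteq> 0"
    and e1: "unit_vec 1 \<in> closure (range (\<lambda>y. T y - z *\<^sub>C y))"
  shows "closure (range (\<lambda>y. T y - z *\<^sub>C y)) = UNIV"
proof -
  define A where "A = (\<lambda>y. T y - z *\<^sub>C y)"
  define R where "R = closure (range A)"
  have A: "coord (A y) n = a (n - 1) * coord y (n - 1) + (b n - z) * coord y n + c n * coord y (n + 1)"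
    if "n \<ge> 1" for y n
    using T that unfolding jacobi_operator_def A_def by (simp add: algebra_simps)
  have add: "x + y \<in> R" if "x \<in> R" "y \<in> R" for x y
  proof -
    have "x + y \<in> R + R"
      using that by (auto simp: set_plus_def)
    also have "R + R \<subseteq> closure (range A + range A)"
      unfolding R_def by (rule closure_sum)
    also have "range A + range A \<subseteq> range A"
    proof (rule subsetI, elim set_plus_elim imageE)
      fix u x y v w
      assume *: "u = x + y" "x = A v" "y = A w"
      have "A v + A w = A (v + w)"
        by (rule ell2_eqI) (simp add: A algebra_simps)
      thus "u \<in> range A" using * by simp
    qed
    hence "closure (range A + range A) \<subseteq> R"
      unfolding R_def by (rule closure_mono)
    finally show ?thesis .
  qed
  have scale: "k *\<^sub>C x \<in> R" if "x \<in> R" for k x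
  proof -
    have "k *\<^sub>C x \<in> closure ((\<lambda>x. k *\<^sub>C x) ` range A)"
      using closure_bounded_linear_image_subset[OF bounded_linear_scaleC[of k], of "range A"] that
      unfolding R_def by blast
    also have "(\<lambda>x. k *\<^sub>C x) ` range A \<subseteq> range A"
    proof safe
      fix u
      have "k *\<^sub>C A u = A (k *\<^sub>C u)"
        by (rule ell2_eqI) (simp add: A algebra_simps)
      thus "k *\<^sub>C A u \<in> range A" by simp
    qed
    hence "closure ((\<lambda>x. k *\<^sub>C x) ` range A) \<subseteq> R"
      unfolding R_def by (rule closure_mono)
    finally show ?thesis .
  qed
  have zero: "0 \<in> R"
  proof -
    have "A 0 = 0" by (rule ell2_eqI) (simp add: A)
    hence "0 \<in> range A" using rangeI[of A 0] by simp
    thus ?thesis using closure_subset[of "range A"] unfolding R_def by blast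
  qed
  have uv: "unit_vec n \<in> R" for n
  proof (induction n rule: less_induct)
    case (less n)
    consider "n = 0" | "n = 1" | m where "n = Suc (Suc m)"
      by (metis One_nat_def not0_implies_Suc)
    thus ?case
    proof cases
      case 1
      hence "unit_vec n = 0" by (intro ell2_eqI) (simp add: coord_unit_vec)
      thus ?thesis using zero by simp
    next
      case 2
      thus ?thesis using e1 by (simp add: R_def A_def)
    next
      case 3
      \<comment> \<open>For m = 0 the last summand is harmless: \<open>unit_vec 0\<close> is the
        zero vector.\<close>
      have "unit_vec n = (1 / a (Suc m)) *\<^sub>C (A (unit_vec (Suc m)) + (z - b (Suc m)) *\<^sub>C unit_vec (Suc m)
              + (- c m) *\<^sub>C unit_vec m)"
        by (rule ell2_eqI) (use 3 a[of "Suc m"] in \<open>auto simp: A coord_unit_vec field_simps\<close>)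
      moreover have "A (unit_vec (Suc m)) \<in> R"
        unfolding R_def using closure_subset[of "range A"] by blast
      ultimately show ?thesis
        using 3 less[of m] less[of "Suc m"] by (metis add scale lessI less_SucI)
    qed
  qed
  have "f \<in> R" for f
  proof -
    define g where "g = (\<lambda>N. \<Sum>n<N. coord f n *\<^sub>C unit_vec n)"
    have gR: "g N \<in> R" for N
      unfolding g_def by (induction N) (auto intro: zero add scale uv)
    have cg: "coord (g N) k = (if k < N then coord f k else 0)" for N k
      unfolding g_def by (induction N) (auto simp: coord_unit_vec less_Suc_eq)
    have "(norm (f - g N))\<^sup>2 = (\<Sum>n. (cmod (coord f (n + N)))\<^sup>2)" for N
    proof -
      have s: "summable (\<lambda>n. (cmod (coord (f - g N) n))\<^sup>2)" by (rule summable_coord)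
      show ?thesis unfolding norm_ell2_sq
        by (subst suminf_split_initial_segment[OF s, of N]) (simp add: cg)
    qed
    moreover have "(\<lambda>N. \<Sum>n. (cmod (coord f (n + N)))\<^sup>2) \<longlonglongrightarrow> 0"
      using suminf_exist_split2[OF summable_coord[of f]] .
    ultimately have "(\<lambda>N. (norm (f - g N))\<^sup>2) \<longlonglongrightarrow> 0" by simp
    hence "(\<lambda>N. sqrt ((norm (f - g N))\<^sup>2)) \<longlonglongrightarrow> sqrt 0" by (rule tendsto_real_sqrt)
    hence "(\<lambda>N. norm (g N - f)) \<longlonglongrightarrow> 0" by (simp add: norm_minus_commute)
    hence "g \<longlonglongrightarrow> f"
      by (rule LIM_zero_cancel[OF tendsto_norm_zero_cancel])
    moreover have "closed R" by (simp add: R_def)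
    ultimately show ?thesis
      using closed_sequentially[of R g f] gR by blast
  qed
  thus ?thesis unfolding R_def A_def by blast
qed

section \<open>Green functions of three-term recurrences\<close>

text \<open>Convexity of the square with weights \<rho> and 1 - \<rho>, applied to x and g / (1 -
  \<rho>).\<close>

lemma square_convex_bound:
  fixes \<rho> x g :: real
  assumes "0 < \<rho>" "\<rho> < 1"
  shows "(\<rho> * x + g)\<^sup>2 \<le> \<rho> * x\<^sup>2 + g\<^sup>2 / (1 - \<rho>)"
proof -
  define h where "h = g / (1 - \<rho>)"
  have g: "g = (1 - \<rho>) * h" using assms by (simp add: h_def)
  have "g\<^sup>2 / (1 - \<rho>) = (1 - \<rho>) * h\<^sup>2"
    using assms unfolding g by (simp add: power2_eq_square)
  hence "\<rho> * x\<^sup>2 + g\<^sup>2 / (1 - \<rho>) - (\<rho> * x + g)\<^sup>2 = \<rho> * (1 - \<rho>) * (x - h)\<^sup>2"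
    unfolding g by (simp add: algebra_simps power2_eq_square)
  moreover have "\<dots> \<ge> 0" using assms by simp
  ultimately show ?thesis by linarith
qed

text \<open>Square summability of a convolution with a geometric kernel, read off from the recursion
  that such a convolution satisfies. It serves for the part of the Green function below the
  diagonal.\<close>

lemma summable_square_forward:
  fixes T g :: "nat \<Rightarrow> real"
  assumes \<rho>: "0 < \<rho>" "\<rho> < 1" and T: "\<And>n. 0 \<le> T n"
    and rec: "\<And>n. T (Suc n) \<le> \<rho> * T n + g n" and g: "summable (\<lambda>n. (g n)\<^sup>2)"
  shows "summable (\<lambda>n. (T n)\<^sup>2)"
proof (rule summableI_nonneg_bounded)
  define G where "G = (\<Sum>n. (g n)\<^sup>2)"
  fix N
  have "(\<Sum>n<N. (T n)\<^sup>2) \<le> (\<Sum>n<Suc N. (T n)\<^sup>2)" by simp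
  also have "\<dots> = (T 0)\<^sup>2 + (\<Sum>n<N. (T (Suc n))\<^sup>2)"
    by (rule sum.lessThan_Suc_shift)
  also have "(\<Sum>n<N. (T (Suc n))\<^sup>2) \<le> (\<Sum>n<N. \<rho> * (T n)\<^sup>2 + (g n)\<^sup>2 / (1 - \<rho>))"
  proof (rule sum_mono)
    fix n
    have "(T (Suc n))\<^sup>2 \<le> (\<rho> * T n + g n)\<^sup>2"
      by (intro power_mono rec T)
    also have "\<dots> \<le> \<rho> * (T n)\<^sup>2 + (g n)\<^sup>2 / (1 - \<rho>)"
      by (rule square_convex_bound[OF \<rho>])
    finally show "(T (Suc n))\<^sup>2 \<le> \<rho> * (T n)\<^sup>2 + (g n)\<^sup>2 / (1 - \<rho>)" .
  qed
  also have "\<dots> = \<rho> * (\<Sum>n<N. (T n)\<^sup>2) + (\<Sum>n<N. (g n)\<^sup>2) / (1 - \<rho>)"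
    by (simp add: sum.distrib sum_distrib_left sum_divide_distrib)
  also have "(\<Sum>n<N. (g n)\<^sup>2) \<le> G"
    unfolding G_def by (intro sum_le_suminf g) auto
  finally have "(1 - \<rho>) * (\<Sum>n<N. (T n)\<^sup>2) \<le> (T 0)\<^sup>2 + G / (1 - \<rho>)"
    using \<rho> by (simp add: divide_right_mono algebra_simps)
  thus "(\<Sum>n<N. (T n)\<^sup>2) \<le> ((T 0)\<^sup>2 + G / (1 - \<rho>)) / (1 - \<rho>)"
    using \<rho> by (simp add: pos_le_divide_eq mult.commute)
qed auto

text \<open>The mirror image, for the part above the diagonal. The recursion runs towards larger
  indices, so a partial sum meets the term at its upper end; the a priori bound K controls
  it.\<close>

lemma summable_square_backward:
  fixes T g :: "nat \<Rightarrow> real"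
  assumes \<rho>: "0 < \<rho>" "\<rho> < 1" and T: "\<And>n. 0 \<le> T n" "\<And>n. T n \<le> K"
    and rec: "\<And>n. T n \<le> \<rho> * T (Suc n) + g n" and g: "summable (\<lambda>n. (g n)\<^sup>2)"
  shows "summable (\<lambda>n. (T n)\<^sup>2)"
proof (rule summableI_nonneg_bounded)
  define G where "G = (\<Sum>n. (g n)\<^sup>2)"
  fix N
  have "(\<Sum>n<N. (T n)\<^sup>2) \<le> (\<Sum>n<N. \<rho> * (T (Suc n))\<^sup>2 + (g n)\<^sup>2 / (1 - \<rho>))"
  proof (rule sum_mono)
    fix n
    have "(T n)\<^sup>2 \<le> (\<rho> * T (Suc n) + g n)\<^sup>2"
      by (intro power_mono rec T)
    also have "\<dots> \<le> \<rho> * (T (Suc n))\<^sup>2 + (g n)\<^sup>2 / (1 - \<rho>)"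
      by (rule square_convex_bound[OF \<rho>])
    finally show "(T n)\<^sup>2 \<le> \<rho> * (T (Suc n))\<^sup>2 + (g n)\<^sup>2 / (1 - \<rho>)" .
  qed
  also have "\<dots> = \<rho> * (\<Sum>n<N. (T (Suc n))\<^sup>2) + (\<Sum>n<N. (g n)\<^sup>2) / (1 - \<rho>)"
    by (simp add: sum.distrib sum_distrib_left sum_divide_distrib)
  also have "(\<Sum>n<N. (g n)\<^sup>2) \<le> G"
    unfolding G_def by (intro sum_le_suminf g) auto
  also have "(\<Sum>n<N. (T (Suc n))\<^sup>2) \<le> (\<Sum>n<N. (T n)\<^sup>2) + K\<^sup>2"
  proof -
    have "(T 0)\<^sup>2 + (\<Sum>n<N. (T (Suc n))\<^sup>2) = (\<Sum>n<N. (T n)\<^sup>2) + (T N)\<^sup>2"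
      using sum.lessThan_Suc_shift[of "\<lambda>n. (T n)\<^sup>2" N] by simp
    moreover have "(T N)\<^sup>2 \<le> K\<^sup>2" by (intro power_mono T)
    ultimately show ?thesis using zero_le_power2[of "T 0"] by linarith
  qed
  finally have "(1 - \<rho>) * (\<Sum>n<N. (T n)\<^sup>2) \<le> \<rho> * K\<^sup>2 + G / (1 - \<rho>)"
    using \<rho> by (simp add: divide_right_mono algebra_simps)
  thus "(\<Sum>n<N. (T n)\<^sup>2) \<le> (\<rho> * K\<^sup>2 + G / (1 - \<rho>)) / (1 - \<rho>)"
    using \<rho> by (simp add: pos_le_divide_eq mult.commute)
qed auto

section \<open>Discrete Wronskians and the abstract Green function\<close>

definition three_term ::
    "(nat \<Rightarrow> complex) \<Rightarrow> (nat \<Rightarrow> complex) \<Rightarrow> complex \<Rightarrow> (nat \<Rightarrow> complex) \<Rightarrow> nat \<Rightarrow> complex" where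
  "three_term A B z y n = A (n - 1) * y (n - 1) + (B n - z) * y n + A n * y (n + 1)"

definition wronskian ::
    "(nat \<Rightarrow> complex) \<Rightarrow> (nat \<Rightarrow> complex) \<Rightarrow> (nat \<Rightarrow> complex) \<Rightarrow> nat \<Rightarrow> complex" where
  "wronskian A f g n = A n * (f n * g (n + 1) - f (n + 1) * g n)"

text \<open>Lagrange's identity: the diagonal terms cancel in f (\<tau> g) - g (\<tau> f), and the
  remaining terms telescope.\<close>

lemma wronskian_step:
  assumes "n \<ge> 1" "three_term A B z f n = 0"
  shows "f n * three_term A B z g n = wronskian A f g n - wronskian A f g (n - 1)"
proof -
  have "f n * three_term A B z g n = f n * three_term A B z g n - g n * three_term A B z f n"
    using assms by simp
  also have "\<dots> = wronskian A f g n - wronskian A f g (n - 1)"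
    using assms(1) by (simp add: three_term_def wronskian_def algebra_simps)
  finally show ?thesis .
qed

lemma sum_wronskian:
  assumes "n \<le> M" "\<And>m. n < m \<Longrightarrow> three_term A B z f m = 0"
  shows "(\<Sum>m\<in>{n<..M}. f m * three_term A B z g m) = wronskian A f g M - wronskian A f g n"
  using assms(1)
proof (induction M rule: dec_induct)
  case base
  then show ?case by simp
next
  case (step M)
  have "{n<..Suc M} = insert (Suc M) {n<..M}" using step by auto
  thus ?case
    using step assms(2)[of "Suc M"] wronskian_step[of "Suc M" A B z f g] by simp
qed

text \<open>The Dirichlet solution \<phi> may grow exponentially, so neither solution is estimated
  alone: the hypothesis bounds the product of \<phi> with the decaying \<psi> at a later site,
  uniformly up to a power of the distance. The Wronskian is prescribed at 0 only, since its
  constancy follows.\<close>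

locale green_pair =
  fixes A B :: "nat \<Rightarrow> complex" and z :: complex and \<phi> \<psi> :: "nat \<Rightarrow> complex"
    and W :: complex and C \<rho> :: real
  assumes \<phi>: "\<And>n. n \<ge> 1 \<Longrightarrow> three_term A B z \<phi> n = 0"
    and \<psi>: "\<And>n. n \<ge> 1 \<Longrightarrow> three_term A B z \<psi> n = 0"
    and \<phi>0: "\<phi> 0 = 0" and \<phi>1: "\<phi> 1 = 1"
    and W0: "wronskian A \<phi> \<psi> 0 = W" and W: "W \<noteq> 0"
    and \<rho>: "0 < \<rho>" "\<rho> < 1"
    and bound: "\<And>n m. n \<ge> 1 \<Longrightarrow> n \<le> m \<Longrightarrow> cmod (\<phi> n * \<psi> m) \<le> C * \<rho> ^ (m - n)"
begin

lemma wronskian_const: "wronskian A \<phi> \<psi> n = W"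
  using sum_wronskian[of 0 n A B z \<phi> \<psi>] \<phi> \<psi> W0 by simp

lemma C_nonneg: "C \<ge> 0"
  using bound[of 1 1] norm_ge_zero[of "\<phi> 1 * \<psi> 1"] by (simp del: norm_ge_zero)

lemma psi_bound: "m \<ge> 1 \<Longrightarrow> cmod (\<psi> m) \<le> C * \<rho> ^ (m - 1)"
  using bound[of 1 m] \<phi>1 by simp

text \<open>Variation of constants on a finite stretch. Nothing is assumed about v at infinity; the
  price is the Wronskian at M, to be removed by letting M tend to infinity. Both sums are Wronskian
  differences, and what is left at n recombines to W times \<open>v n\<close>.\<close>

lemma representation:
  assumes v0: "v 0 = 0" and nM: "n \<le> M"
  shows "W * v n = \<psi> n * (\<Sum>m\<in>{0<..n}. \<phi> m * three_term A B z v m)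
     + \<phi> n * (\<Sum>m\<in>{n<..M}. \<psi> m * three_term A B z v m) - \<phi> n * wronskian A \<psi> v M"
proof -
  have 1: "(\<Sum>m\<in>{0<..n}. \<phi> m * three_term A B z v m) = wronskian A \<phi> v n"
    using sum_wronskian[of 0 n A B z \<phi> v] \<phi> v0 \<phi>0 by (simp add: wronskian_def)
  have 2: "(\<Sum>m\<in>{n<..M}. \<psi> m * three_term A B z v m) = wronskian A \<psi> v M - wronskian A \<psi> v n"
    using sum_wronskian[of n M A B z \<psi> v] \<psi> nM by simp
  have 3: "W = A n * (\<phi> n * \<psi> (n + 1) - \<phi> (n + 1) * \<psi> n)"
    using wronskian_const[of n] by (simp add: wronskian_def)
  show ?thesis unfolding 1 2 3 by (simp add: wronskian_def algebra_simps)
qed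

text \<open>
  The supremum \<open>X\<close> of \<open>|v\<^sub>n| q\<^sup>n\<close> satisfies \<open>|W| X \<le> C (\<Sum> \<delta>\<^sub>m) X\<close>. The weight is harmless
  because the Green function decays like \<open>\<rho>\<close> to the power \<open>|n - m|\<close> and \<open>\<rho> < q\<close>.
\<close>

lemma trivial_if_small_perturbation:
  fixes v :: "nat \<Rightarrow> complex" and \<delta> :: "nat \<Rightarrow> real"
  assumes v0: "v 0 = 0" and q: "\<rho> < q" "q < 1"
    and v: "\<And>n. cmod (v n) * q ^ n \<le> X0" and A: "\<And>n. cmod (A n) \<le> A0"
    and h: "\<And>m. m \<ge> 1 \<Longrightarrow>
      cmod (three_term A B z v m) \<le> \<delta> m * max (cmod (v m)) (cmod (v (m - 1)))"
    and \<delta>: "\<And>m. \<delta> m \<ge> 0" "summable (\<lambda>m. \<delta> (Suc m))"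
    and small: "C * (\<Sum>m. \<delta> (Suc m)) < cmod W"
  shows "v n = 0"
proof -
  define X where "X = (SUP n. cmod (v n) * q ^ n)"
  define D where "D = (\<Sum>m. \<delta> (Suc m))"
  have q0: "q > 0" using q \<rho> by linarith
  have bdd: "bdd_above (range (\<lambda>n. cmod (v n) * q ^ n))"
    using v by (auto simp: bdd_above_def)
  have X: "cmod (v n) * q ^ n \<le> X" for n
    unfolding X_def by (rule cSUP_upper[OF _ bdd]) simp
  have X_nonneg: "X \<ge> 0" using X[of 0] v0 by simp
  have hX: "cmod (three_term A B z v m) * q ^ m \<le> \<delta> m * X" if "m \<ge> 1" for m
  proof -
    have "cmod (v (m - 1)) * q ^ m = (cmod (v (m - 1)) * q ^ (m - 1)) * q"
      using that by (simp flip: power_Suc2)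
    also have "\<dots> \<le> X * 1"
      using q q0 X_nonneg by (intro mult_mono X) auto
    finally have "max (cmod (v m)) (cmod (v (m - 1))) * q ^ m \<le> X"
      using X[of m] by (auto simp: max_def)
    hence "\<delta> m * (max (cmod (v m)) (cmod (v (m - 1))) * q ^ m) \<le> \<delta> m * X"
      by (intro mult_left_mono \<delta>)
    moreover have "cmod (three_term A B z v m) * q ^ m
        \<le> (\<delta> m * max (cmod (v m)) (cmod (v (m - 1)))) * q ^ m"
      using h[OF that] q0 by (intro mult_right_mono) auto
    ultimately show ?thesis by (simp add: mult.assoc)
  qed
  \<comment> \<open>For m \<le> n the weight is on the good side, as q^n \<le> q^m, and the bound C
    alone suffices.\<close>
  have left: "cmod (\<psi> n * \<phi> m * three_term A B z v m) * q ^ n \<le> C * (\<delta> m * X)"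
    if "m \<ge> 1" "m \<le> n" for m n
  proof -
    have "cmod (\<psi> n * \<phi> m * three_term A B z v m) * q ^ n
        = cmod (\<phi> m * \<psi> n) * (q ^ (n - m) * (cmod (three_term A B z v m) * q ^ m))"
      using that by (simp add: norm_mult flip: power_add)
    also have "\<dots> \<le> (C * 1) * (1 * (\<delta> m * X))"
    proof (rule mult_mono)
      have "C * \<rho> ^ (n - m) \<le> C * 1"
        using \<rho> C_nonneg by (intro mult_left_mono power_le_one) auto
      thus "cmod (\<phi> m * \<psi> n) \<le> C * 1" using bound[OF that] by linarith
      show "q ^ (n - m) * (cmod (three_term A B z v m) * q ^ m) \<le> 1 * (\<delta> m * X)"
        using q q0 by (intro mult_mono[OF power_le_one hX[OF that(1)]]) auto
    qed (use q0 C_nonneg in auto)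
    finally show ?thesis by simp
  qed
  \<comment> \<open>For m > n the weight costs the factor q^(n - m) in passing from site m to n; the
    decay \<rho>^(m - n) \<le> q^(m - n) of the Green function pays for it.\<close>
  have right: "cmod (\<phi> n * \<psi> m * three_term A B z v m) * q ^ n \<le> C * (\<delta> m * X)"
    if "n \<ge> 1" "n < m" for m n
  proof -
    have "cmod (\<phi> n * \<psi> m * three_term A B z v m) * q ^ n
       \<le> (C * \<rho> ^ (m - n)) * cmod (three_term A B z v m) * q ^ n"
      unfolding norm_mult[of "\<phi> n * \<psi> m"] using that q0
      by (intro mult_right_mono bound) auto
    also have "\<dots> \<le> (C * q ^ (m - n)) * cmod (three_term A B z v m) * q ^ n"
      using q \<rho> C_nonneg q0 by (intro mult_right_mono mult_left_mono power_mono) auto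
    also have "\<dots> = C * (cmod (three_term A B z v m) * q ^ m)"
      using that by (simp flip: power_add)
    also have "\<dots> \<le> C * (\<delta> m * X)"
      using C_nonneg hX[of m] that by (intro mult_left_mono) auto
    finally show ?thesis .
  qed
  have sumD: "(\<Sum>m\<in>{0<..M}. \<delta> m) \<le> D" for M
  proof -
    have "(\<Sum>m\<in>{0<..M}. \<delta> m) = (\<Sum>m<M. \<delta> (Suc m))"
      by (rule sum.reindex_bij_witness[of _ Suc "\<lambda>m. m - 1"]) auto
    also have "\<dots> \<le> D" unfolding D_def using \<delta> by (intro sum_le_suminf) auto
    finally show ?thesis .
  qed
  have main: "cmod W * (cmod (v n) * q ^ n) \<le> C * (D * X) + cmod (\<phi> n) * q ^ n * cmod (wronskian A \<psi> v M)"
    if "n \<ge> 1" "n \<le> M" for n M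
  proof -
    define h where "h = three_term A B z v"
    have split: "{0<..M} = {0<..n} \<union> {n<..M}" using that by auto
    have "cmod (W * v n) \<le> cmod (\<Sum>m\<in>{0<..n}. \<psi> n * \<phi> m * h m)
       + cmod (\<Sum>m\<in>{n<..M}. \<phi> n * \<psi> m * h m) + cmod (\<phi> n * wronskian A \<psi> v M)"
      unfolding representation[of v, OF v0 that(2)] h_def[symmetric]
      by (simp add: sum_distrib_left mult.assoc norm_triangle_le_diff norm_triangle_ineq)
    also have "\<dots> \<le> (\<Sum>m\<in>{0<..n}. cmod (\<psi> n * \<phi> m * h m))
       + (\<Sum>m\<in>{n<..M}. cmod (\<phi> n * \<psi> m * h m)) + cmod (\<phi> n * wronskian A \<psi> v M)"
      by (intro add_mono norm_sum order_refl)
    finally have "cmod (W * v n) * q ^ n \<le> ((\<Sum>m\<in>{0<..n}. cmod (\<psi> n * \<phi> m * h m))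
       + (\<Sum>m\<in>{n<..M}. cmod (\<phi> n * \<psi> m * h m)) + cmod (\<phi> n * wronskian A \<psi> v M)) * q ^ n"
      using q0 by (intro mult_right_mono) auto
    also have "\<dots> = (\<Sum>m\<in>{0<..n}. cmod (\<psi> n * \<phi> m * h m) * q ^ n)
       + (\<Sum>m\<in>{n<..M}. cmod (\<phi> n * \<psi> m * h m) * q ^ n) + cmod (\<phi> n) * q ^ n * cmod (wronskian A \<psi> v M)"
      by (simp add: distrib_right sum_distrib_right norm_mult)
    also have "\<dots> \<le> (\<Sum>m\<in>{0<..n}. C * (\<delta> m * X)) + (\<Sum>m\<in>{n<..M}. C * (\<delta> m * X))
        + cmod (\<phi> n) * q ^ n * cmod (wronskian A \<psi> v M)"
      unfolding h_def using that by (intro add_mono sum_mono order_refl left right) auto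
    also have "(\<Sum>m\<in>{0<..n}. C * (\<delta> m * X)) + (\<Sum>m\<in>{n<..M}. C * (\<delta> m * X))
        = C * ((\<Sum>m\<in>{0<..M}. \<delta> m) * X)"
      unfolding split by (subst sum.union_disjoint) (auto simp: sum_distrib_left sum_distrib_right algebra_simps)
    also have "\<dots> \<le> C * (D * X)"
      using C_nonneg X_nonneg by (intro mult_left_mono mult_right_mono sumD)
    finally show ?thesis by (simp add: norm_mult mult.assoc)
  qed
  have A0: "A0 \<ge> 0" using A[of 0] norm_ge_zero order_trans by blast
  \<comment> \<open>Here \<psi> decays like \<rho>^M and v grows at most like q^(-M), so the product
    decays because \<rho> < q.\<close>
  have lim: "(\<lambda>M. wronskian A \<psi> v M) \<longlonglongrightarrow> 0"
  proof (rule Lim_null_comparison)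
    define K where "K = A0 * (C * X) * (1 / (\<rho> * q) + 1)"
    show "\<forall>\<^sub>F M in sequentially. cmod (wronskian A \<psi> v M) \<le> K * (\<rho> / q) ^ M"
    proof (rule eventually_sequentiallyI[of 1])
      fix M :: nat assume M: "M \<ge> 1"
      have vX: "cmod (v n) \<le> X / q ^ n" for n
        using X[of n] q0 by (simp add: field_simps)
      have "cmod (wronskian A \<psi> v M) \<le> cmod (A M) * (cmod (\<psi> M) * cmod (v (M + 1)) + cmod (\<psi> (M + 1)) * cmod (v M))"
        unfolding wronskian_def norm_mult
        by (intro mult_left_mono order_trans[OF norm_triangle_ineq4]) (auto simp: norm_mult)
      also have "\<dots> \<le> A0 * ((C * \<rho> ^ (M - 1)) * (X / q ^ (M + 1)) + (C * \<rho> ^ M) * (X / q ^ M))"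
        using psi_bound[of M] psi_bound[of "M + 1"] M A0 C_nonneg \<rho>
        by (intro mult_mono add_mono A vX) (auto intro!: add_nonneg_nonneg mult_nonneg_nonneg)
      also have "\<rho> ^ (M - 1) = \<rho> ^ M / \<rho>"
        using \<rho> M by (simp add: power_diff)
      also have "A0 * ((C * (\<rho> ^ M / \<rho>)) * (X / q ^ (M + 1)) + (C * \<rho> ^ M) * (X / q ^ M)) = K * (\<rho> / q) ^ M"
        using \<rho> q0 unfolding K_def by (simp add: field_simps)
      finally show "cmod (wronskian A \<psi> v M) \<le> K * (\<rho> / q) ^ M" .
    qed
    have "(\<lambda>M. (\<rho> / q) ^ M) \<longlonglongrightarrow> 0"
      using \<rho> q q0 by (intro LIMSEQ_realpow_zero) auto
    thus "(\<lambda>M. K * (\<rho> / q) ^ M) \<longlonglongrightarrow> 0"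
      using tendsto_mult_right_zero by blast
  qed
  have step: "cmod W * (cmod (v n) * q ^ n) \<le> C * (D * X)" for n
  proof (cases "n = 0")
    case True
    have "D \<ge> 0" unfolding D_def using \<delta> by (intro suminf_nonneg) auto
    thus ?thesis using True v0 C_nonneg X_nonneg by simp
  next
    case False
    have "(\<lambda>M. C * (D * X) + cmod (\<phi> n) * q ^ n * cmod (wronskian A \<psi> v M))
        \<longlonglongrightarrow> C * (D * X) + cmod (\<phi> n) * q ^ n * cmod 0"
      by (intro tendsto_intros lim)
    hence "cmod W * (cmod (v n) * q ^ n) \<le> C * (D * X) + cmod (\<phi> n) * q ^ n * cmod 0"
      by (rule LIMSEQ_le_const) (use main[of n] False in \<open>auto intro!: exI[of _ n]\<close>)
    thus ?thesis by simp
  qed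
  have "cmod (v n) * q ^ n \<le> C * (D * X) / cmod W" for n
    using step[of n] W by (simp add: field_simps)
  hence "X \<le> C * (D * X) / cmod W"
    unfolding X_def by (intro cSUP_least) auto
  hence "cmod W * X \<le> C * D * X"
    using W by (simp add: field_simps)
  hence "X \<le> 0"
    using small unfolding D_def[symmetric] by (meson mult_less_cancel_right linorder_not_le)
  hence "cmod (v n) * q ^ n \<le> 0" using X[of n] by linarith
  thus ?thesis using q0 zero_less_power[OF q0, of n] by (auto simp: mult_le_0_iff)
qed

text \<open>The Green function maps square-summable data to square-summable solutions; this yields
  surjectivity of the shifted operator off the bands.\<close>

lemma inhomogeneous_solution:
  fixes f :: "nat \<Rightarrow> complex"
  assumes f: "summable (\<lambda>n. (cmod (f n))\<^sup>2)"
  shows "\<exists>y. y 0 = 0 \<and> summable (\<lambda>n. (cmod (y n))\<^sup>2) \<and> (\<forall>n\<ge>1. three_term A B z y n = f n)"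
proof -
  obtain F where F: "\<And>n. cmod (f n) \<le> F"
  proof -
    have "(\<lambda>n. sqrt ((cmod (f n))\<^sup>2)) \<longlonglongrightarrow> sqrt 0"
      by (intro tendsto_real_sqrt summable_LIMSEQ_zero f)
    hence "f \<longlonglongrightarrow> 0" by (simp add: tendsto_norm_zero_iff)
    hence "Bseq f" by (intro convergent_imp_Bseq) (auto simp: convergent_def)
    thus ?thesis using that by (auto simp: Bseq_def)
  qed
  have geo: "summable (\<lambda>k. \<rho> ^ k * cmod (f (k + n)))" for n
  proof (rule summable_comparison_test')
    show "summable (\<lambda>k. \<rho> ^ k * F)"
      using \<rho> by (intro summable_mult2 summable_geometric) auto
    show "norm (\<rho> ^ k * cmod (f (k + n))) \<le> \<rho> ^ k * F" if "k \<ge> 0" for k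
      using \<rho> F by (simp add: abs_mult)
  qed
  define L where "L = (\<lambda>n. \<Sum>m\<in>{0<..n}. \<phi> m * f m)"
  define R where "R = (\<lambda>n. \<Sum>k. \<psi> (k + Suc n) * f (k + Suc n))"
  \<comment> \<open>P and Q majorize the two halves of the solution up to the constant C / |W|, and
    they satisfy the recursions of the two summability lemmas.\<close>
  define P where "P = (\<lambda>n. \<Sum>m\<in>{0<..n}. \<rho> ^ (n - m) * cmod (f m))"
  define Q where "Q = (\<lambda>n. \<Sum>k. \<rho> ^ k * cmod (f (k + Suc n)))"
  define y where "y = (\<lambda>n. (\<psi> n * L n + \<phi> n * R n) / W)"
  have psi_f: "summable (\<lambda>k. \<psi> (k + Suc n) * f (k + Suc n))" for n
  proof (rule summable_comparison_test')
    show "summable (\<lambda>k. C * \<rho> ^ n * (\<rho> ^ k * cmod (f (k + Suc n))))"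
      by (intro summable_mult geo)
    show "norm (\<psi> (k + Suc n) * f (k + Suc n)) \<le> C * \<rho> ^ n * (\<rho> ^ k * cmod (f (k + Suc n)))"
      if "k \<ge> 0" for k
    proof -
      have "cmod (\<psi> (k + Suc n)) * cmod (f (k + Suc n)) \<le> (C * \<rho> ^ (k + n)) * cmod (f (k + Suc n))"
        using psi_bound[of "k + Suc n"] by (intro mult_right_mono) auto
      thus ?thesis by (simp add: norm_mult power_add mult_ac)
    qed
  qed
  have R_rec: "R n = \<psi> (Suc n) * f (Suc n) + R (Suc n)" for n
    using suminf_split_head[OF psi_f[of n]] by (simp add: R_def)
  have L_rec: "L (Suc n) = L n + \<phi> (Suc n) * f (Suc n)" for n
  proof -
    have "{0<..Suc n} = insert (Suc n) {0<..n}" by auto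
    thus ?thesis by (simp add: L_def)
  qed
  have y0: "y 0 = 0" by (simp add: y_def L_def \<phi>0)
  have eq: "three_term A B z y n = f n" if "n \<ge> 1" for n
  proof -
    obtain m where n: "n = Suc m" using \<open>n \<ge> 1\<close> by (cases n) auto
    have "W * three_term A B z y n = W * (A m * y m) + (B n - z) * (W * y n) + A n * (W * y (Suc n))"
      by (simp add: three_term_def n algebra_simps)
    also have "\<dots> = A m * (\<psi> m * L m + \<phi> m * R m) + (B n - z) * (\<psi> n * L n + \<phi> n * R n)
         + A n * (\<psi> (Suc n) * L (Suc n) + \<phi> (Suc n) * R (Suc n))"
      using W by (simp add: y_def)
    \<comment> \<open>All sums are moved to the base point n. The homogeneous parts then vanish, and
      the correction terms combine to the Wronskian of \<phi> and \<psi> times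
      \<open>f n\<close>.\<close>
    also have "L m = L n - \<phi> n * f n" using L_rec[of m] n by simp
    also have "R m = R n + \<psi> n * f n" using R_rec[of m] n by simp
    also have "L (Suc n) = L n + \<phi> (Suc n) * f (Suc n)" by (rule L_rec)
    also have "R (Suc n) = R n - \<psi> (Suc n) * f (Suc n)" using R_rec[of n] by simp
    also have "A m * (\<psi> m * (L n - \<phi> n * f n) + \<phi> m * (R n + \<psi> n * f n)) + (B n - z) * (\<psi> n * L n + \<phi> n * R n)
         + A n * (\<psi> (Suc n) * (L n + \<phi> (Suc n) * f (Suc n)) + \<phi> (Suc n) * (R n - \<psi> (Suc n) * f (Suc n)))
        = three_term A B z \<psi> n * L n + three_term A B z \<phi> n * R n + wronskian A \<phi> \<psi> m * f n"
      by (simp add: three_term_def wronskian_def n algebra_simps)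
    also have "\<dots> = W * f n"
      using \<phi> \<psi> that wronskian_const by simp
    finally show ?thesis using W by simp
  qed
  have bnd: "cmod (y n) \<le> C / cmod W * (P n + Q n)" if "n \<ge> 1" for n
  proof -
    have "cmod (\<psi> n * L n) \<le> (\<Sum>m\<in>{0<..n}. cmod (\<phi> m * \<psi> n) * cmod (f m))"
      unfolding L_def sum_distrib_left by (rule order_trans[OF norm_sum]) (simp add: norm_mult mult_ac)
    also have "\<dots> \<le> (\<Sum>m\<in>{0<..n}. (C * \<rho> ^ (n - m)) * cmod (f m))"
      by (intro sum_mono mult_right_mono bound) auto
    also have "\<dots> = C * P n"
      by (simp add: P_def sum_distrib_left mult_ac)
    finally have 1: "cmod (\<psi> n * L n) \<le> C * P n" .
    have "\<phi> n * R n = (\<Sum>k. \<phi> n * (\<psi> (k + Suc n) * f (k + Suc n)))"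
      unfolding R_def by (rule suminf_mult[OF psi_f, symmetric])
    also have "cmod \<dots> \<le> (\<Sum>k. C * (\<rho> ^ k * cmod (f (k + Suc n))))"
    proof (rule norm_suminf_le)
      show "summable (\<lambda>k. C * (\<rho> ^ k * cmod (f (k + Suc n))))" by (intro summable_mult geo)
      fix k
      have "cmod (\<phi> n * (\<psi> (k + Suc n) * f (k + Suc n)))
          \<le> (C * \<rho> ^ (Suc k)) * cmod (f (k + Suc n))"
        using bound[OF that, of "k + Suc n"]
        by (subst mult.assoc[symmetric], subst norm_mult) (intro mult_right_mono, auto)
      also have "\<dots> \<le> (C * \<rho> ^ k) * cmod (f (k + Suc n))"
        using C_nonneg \<rho> by (intro mult_right_mono mult_left_mono) (auto intro: power_decreasing)
      finally show "cmod (\<phi> n * (\<psi> (k + Suc n) * f (k + Suc n))) \<le> C * (\<rho> ^ k * cmod (f (k + Suc n)))"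
        by (simp add: mult.assoc)
    qed
    also have "\<dots> = C * Q n" unfolding Q_def by (intro suminf_mult geo)
    finally have "cmod (\<psi> n * L n + \<phi> n * R n) \<le> C * P n + C * Q n"
      using 1 by (intro order_trans[OF norm_triangle_ineq] add_mono)
    thus ?thesis using W by (simp add: y_def norm_divide divide_right_mono flip: distrib_left)
  qed
  have P0: "P n \<ge> 0" for n unfolding P_def using \<rho> by (intro sum_nonneg) auto
  have Q0: "Q n \<ge> 0" for n unfolding Q_def using \<rho> by (intro suminf_nonneg geo) auto
  have "summable (\<lambda>n. (P n)\<^sup>2)"
  proof (rule summable_square_forward[OF \<rho> P0])
    show "summable (\<lambda>n. (cmod (f (Suc n)))\<^sup>2)"
      using f by (subst summable_Suc_iff)
    fix n
    have "{0<..Suc n} = insert (Suc n) {0<..n}" by auto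
    hence "P (Suc n) = (\<Sum>m\<in>{0<..n}. \<rho> ^ (Suc n - m) * cmod (f m)) + cmod (f (Suc n))"
      by (simp add: P_def)
    also have "(\<Sum>m\<in>{0<..n}. \<rho> ^ (Suc n - m) * cmod (f m)) = \<rho> * P n"
      unfolding P_def sum_distrib_left by (intro sum.cong) (auto simp: Suc_diff_le)
    finally show "P (Suc n) \<le> \<rho> * P n + cmod (f (Suc n))" by simp
  qed
  moreover have "summable (\<lambda>n. (Q n)\<^sup>2)"
  proof (rule summable_square_backward[OF \<rho> Q0])
    show "summable (\<lambda>n. (cmod (f (Suc n)))\<^sup>2)"
      using f by (subst summable_Suc_iff)
    fix n
    show "Q n \<le> F / (1 - \<rho>)"
    proof -
      have "Q n \<le> (\<Sum>k. F * \<rho> ^ k)"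
        unfolding Q_def using \<rho> F
        by (intro suminf_le geo summable_mult summable_geometric) (auto simp: mult.commute mult_left_mono)
      also have "\<dots> = F / (1 - \<rho>)"
        using \<rho> by (subst suminf_mult) (auto simp: suminf_geometric summable_geometric)
      finally show ?thesis .
    qed
    have "Q n = cmod (f (Suc n)) + (\<Sum>k. \<rho> * (\<rho> ^ k * cmod (f (k + Suc (Suc n)))))"
      using suminf_split_head[OF geo[of "Suc n"]] by (simp add: Q_def mult.assoc)
    also have "\<dots> = cmod (f (Suc n)) + \<rho> * Q (Suc n)"
      unfolding Q_def by (subst suminf_mult[OF geo]) simp
    finally show "Q n \<le> \<rho> * Q (Suc n) + cmod (f (Suc n))" by simp
  qed
  ultimately have "summable (\<lambda>n. (C / cmod W)\<^sup>2 * (2 * (P n)\<^sup>2 + 2 * (Q n)\<^sup>2))"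
    by (intro summable_mult summable_add)
  hence "summable (\<lambda>n. (cmod (y n))\<^sup>2)"
  proof (rule summable_comparison_test'[of _ 1])
    fix n :: nat assume "n \<ge> 1"
    have "(cmod (y n))\<^sup>2 \<le> (C / cmod W * (P n + Q n))\<^sup>2"
      by (intro power_mono bnd \<open>n \<ge> 1\<close>) auto
    also have "\<dots> = (C / cmod W)\<^sup>2 * (P n + Q n)\<^sup>2" by (rule power_mult_distrib)
    also have "\<dots> \<le> (C / cmod W)\<^sup>2 * (2 * (P n)\<^sup>2 + 2 * (Q n)\<^sup>2)"
      using sum_squares_bound[of "P n" "Q n"] by (intro mult_left_mono) (auto simp: power2_sum)
    finally show "norm ((cmod (y n))\<^sup>2) \<le> (C / cmod W)\<^sup>2 * (2 * (P n)\<^sup>2 + 2 * (Q n)\<^sup>2)" by simp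
  qed
  thus ?thesis using y0 eq by blast
qed

end

section \<open>Floquet solutions of the periodic matrix\<close>

locale periodic_jacobi =
  fixes a0 b0 :: "nat \<Rightarrow> real"
  assumes periodic_a: "\<And>n. n \<ge> 1 \<Longrightarrow> a0 (n + 2) = a0 n"
    and periodic_b: "\<And>n. n \<ge> 1 \<Longrightarrow> b0 (n + 2) = b0 n"
    and positive: "\<And>n. n \<ge> 1 \<Longrightarrow> a0 n > 0"
    and a0_zero: "a0 0 = a0 2"
begin

abbreviation \<alpha> :: real where "\<alpha> \<equiv> a0 1"
abbreviation \<beta> :: real where "\<beta> \<equiv> a0 2"
abbreviation p :: real where "p \<equiv> b0 1"
abbreviation r :: real where "r \<equiv> b0 2"

definition tau :: "complex \<Rightarrow> (nat \<Rightarrow> complex) \<Rightarrow> nat \<Rightarrow> complex" where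
  "tau = three_term (\<lambda>n. of_real (a0 n)) (\<lambda>n. of_real (b0 n))"

text \<open>The characteristic equation of the monodromy matrix over one period, which has
  determinant 1, cleared of the denominator \<alpha> \<beta>. The modulus of \<zeta> is left free,
  because points inside the bands are treated with multipliers on the unit circle.\<close>

definition multiplier :: "complex \<Rightarrow> complex \<Rightarrow> bool" where
  "multiplier z \<zeta> \<longleftrightarrow> \<zeta> \<noteq> 0 \<and>
     (z - of_real p) * (z - of_real r) = of_real (\<alpha>\<^sup>2 + \<beta>\<^sup>2) + of_real (\<alpha> * \<beta>) * (\<zeta> + inverse \<zeta>)"

lemma \<alpha>: "\<alpha> > 0" and \<beta>: "\<beta> > 0"
  using positive[of 1] positive[of 2] by auto

lemma a0_even: "a0 (2 * k) = \<beta>"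
proof (induction k)
  case (Suc k)
  thus ?case using periodic_a[of "2 * k"] a0_zero by (cases "k = 0") auto
qed (simp add: a0_zero)

lemma a0_odd: "a0 (2 * k + 1) = \<alpha>"
  by (induction k) (use periodic_a in \<open>auto simp: numeral_2_eq_2\<close>)

lemma b0_even: "b0 (2 * k + 2) = r"
  by (induction k) (use periodic_b in \<open>auto simp: numeral_2_eq_2\<close>)

lemma b0_odd: "b0 (2 * k + 1) = p"
  by (induction k) (use periodic_b in \<open>auto simp: numeral_2_eq_2\<close>)

lemma tau_odd:
  fixes z :: complex and y :: "nat \<Rightarrow> complex"
  shows "tau z y (2 * k + 1) = \<beta> * y (2 * k) + (p - z) * y (2 * k + 1) + \<alpha> * y (2 * k + 2)"
  using a0_even[of k] a0_odd[of k] b0_odd[of k] by (simp add: tau_def three_term_def)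

lemma tau_even:
  fixes z :: complex and y :: "nat \<Rightarrow> complex"
  shows "tau z y (2 * k + 2) = \<alpha> * y (2 * k + 1) + (r - z) * y (2 * k + 2) + \<beta> * y (2 * k + 3)"
  using a0_even[of "k + 1"] a0_odd[of k] b0_even[of k]
  by (simp add: tau_def three_term_def numeral_3_eq_3)

lemma parity_cases:
  assumes "n \<ge> (1 :: nat)"
  obtains k where "n = 2 * k + 1" | k where "n = 2 * k + 2"
proof (cases "even n")
  case True
  then obtain k where "n = 2 * k" by (elim evenE)
  thus ?thesis using assms that(2)[of "k - 1"] by (cases k) auto
next
  case False
  thus ?thesis using that(1) by (elim oddE) auto
qed

text \<open>
  The decaying Floquet solution and, with \<open>phi 0 = 0\<close> and \<open>phi 1 = 1\<close>, the Dirichlet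
  solution. If \<open>\<alpha> + \<beta> \<zeta> = 0\<close> and \<open>z = r\<close>, then \<open>psi\<close> vanishes identically.
\<close>

definition psi :: "complex \<Rightarrow> complex \<Rightarrow> nat \<Rightarrow> complex" where
  "psi z \<zeta> n = (if even n then (of_real \<alpha> + of_real \<beta> * \<zeta>) * \<zeta> ^ (n div 2)
                else (z - of_real r) * \<zeta> ^ (n div 2 + 1))"

text \<open>For \<zeta> other than 0, 1, -1 this is the Chebyshev polynomial of the second kind of
  degree k - 1 at (\<zeta> + 1/\<zeta>) / 2.\<close>

definition cheb :: "complex \<Rightarrow> nat \<Rightarrow> complex" where
  "cheb \<zeta> k = (inverse \<zeta> ^ k - \<zeta> ^ k) / (inverse \<zeta> - \<zeta>)"

definition phi :: "complex \<Rightarrow> complex \<Rightarrow> nat \<Rightarrow> complex" where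
  "phi z \<zeta> n = (if even n then (z - of_real p) / of_real \<alpha> * cheb \<zeta> (n div 2)
                else cheb \<zeta> (n div 2 + 1) + of_real (\<beta> / \<alpha>) * cheb \<zeta> (n div 2))"

lemma
  fixes z \<zeta> :: complex
  shows psi_even: "psi z \<zeta> (2 * k) = (\<alpha> + \<beta> * \<zeta>) * \<zeta> ^ k"
  and psi_odd: "psi z \<zeta> (2 * k + 1) = (z - r) * \<zeta> ^ (k + 1)"
  and psi_even2: "psi z \<zeta> (2 * k + 2) = (\<alpha> + \<beta> * \<zeta>) * \<zeta> ^ (k + 1)"
  and psi_odd3: "psi z \<zeta> (2 * k + 3) = (z - r) * \<zeta> ^ (k + 2)"
  by (simp_all add: psi_def numeral_3_eq_3)

lemma
  fixes z \<zeta> :: complex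
  shows phi_even: "phi z \<zeta> (2 * k) = (z - p) / \<alpha> * cheb \<zeta> k"
  and phi_odd: "phi z \<zeta> (2 * k + 1) = cheb \<zeta> (k + 1) + \<beta> / \<alpha> * cheb \<zeta> k"
  and phi_even2: "phi z \<zeta> (2 * k + 2) = (z - p) / \<alpha> * cheb \<zeta> (k + 1)"
  and phi_odd3: "phi z \<zeta> (2 * k + 3) = cheb \<zeta> (k + 2) + \<beta> / \<alpha> * cheb \<zeta> (k + 1)"
  by (simp_all add: phi_def numeral_3_eq_3)

text \<open>The quadratic polynomial \<alpha> \<beta> + (\<alpha>^2 + \<beta>^2) \<zeta> + \<alpha>
  \<beta> \<zeta>^2 factors. This locates the zeros of the Wronskian and later bounds z in terms of
  \<zeta>.\<close>

lemma multiplier_key: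
  fixes z \<zeta> :: complex
  assumes "multiplier z \<zeta>"
  shows "(z - p) * (z - r) * \<zeta> = (\<alpha> + \<beta> * \<zeta>) * (\<beta> + \<alpha> * \<zeta>)"
  using assms by (simp add: multiplier_def algebra_simps power2_eq_square)

lemma tau_psi:
  fixes z \<zeta> :: complex
  assumes m: "multiplier z \<zeta>" and n: "n \<ge> 1"
  shows "tau z (psi z \<zeta>) n = 0"
  using n
proof (cases rule: parity_cases)
  case (1 k)
  have "tau z (psi z \<zeta>) n = ((\<alpha> + \<beta> * \<zeta>) * (\<beta> + \<alpha> * \<zeta>) - (z - p) * (z - r) * \<zeta>) * \<zeta> ^ k"
    unfolding 1 tau_odd psi_odd psi_even psi_even2
    by (simp add: algebra_simps)
  thus ?thesis using multiplier_key[OF m] by simp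
next
  case (2 k)
  show ?thesis
    unfolding 2 tau_even psi_odd psi_even2 psi_odd3
    by (simp add: algebra_simps)
qed

lemma cheb_0 [simp]: "cheb \<zeta> 0 = 0"
  by (simp add: cheb_def)

lemma one_minus_sq_nonzero:
  fixes \<zeta> :: complex
  assumes "cmod \<zeta> < 1"
  shows "1 - \<zeta>\<^sup>2 \<noteq> 0"
  using assms by (auto simp: eq_commute[of 1] power2_eq_1_iff)

lemma inverse_minus_nonzero:
  fixes \<zeta> :: complex
  assumes "\<zeta> \<noteq> 0" "cmod \<zeta> < 1"
  shows "inverse \<zeta> - \<zeta> \<noteq> 0"
  using one_minus_sq_nonzero[OF assms(2)] assms(1)
  by (auto simp: field_simps power2_eq_square)

lemma cheb_1 [simp]: "\<zeta> \<noteq> 0 \<Longrightarrow> cmod \<zeta> < 1 \<Longrightarrow> cheb \<zeta> (Suc 0) = 1"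
  using inverse_minus_nonzero[of \<zeta>] by (simp add: cheb_def)

lemma cheb_rec:
  fixes \<zeta> :: complex
  assumes "\<zeta> \<noteq> 0"
  shows "cheb \<zeta> (k + 2) = (\<zeta> + inverse \<zeta>) * cheb \<zeta> (k + 1) - cheb \<zeta> k"
proof -
  have *: "inverse \<zeta> ^ (k + 2) - \<zeta> ^ (k + 2)
      = (\<zeta> + inverse \<zeta>) * (inverse \<zeta> ^ (k + 1) - \<zeta> ^ (k + 1)) - (inverse \<zeta> ^ k - \<zeta> ^ k)"
    using assms by (simp add: field_simps)
  show ?thesis unfolding cheb_def *
    by (simp only: diff_divide_distrib[symmetric] times_divide_eq_right)
qed

lemma tau_phi:
  fixes z \<zeta> :: complex
  assumes m: "multiplier z \<zeta>" and n: "n \<ge> 1"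
  shows "tau z (phi z \<zeta>) n = 0"
  using n
proof (cases rule: parity_cases)
  case (1 k)
  show ?thesis
    unfolding 1 tau_odd phi_odd phi_even phi_even2
    using \<alpha> by (simp add: field_simps)
next
  case (2 k)
  have nz: "\<zeta> \<noteq> 0" using m by (simp add: multiplier_def)
  have "\<alpha> * tau z (phi z \<zeta>) n
      = (\<alpha>\<^sup>2 + \<beta>\<^sup>2 + \<alpha> * \<beta> * (\<zeta> + inverse \<zeta>) - (z - p) * (z - r)) * cheb \<zeta> (k + 1)"
    unfolding 2 tau_even phi_odd phi_even2 phi_odd3 cheb_rec[OF nz]
    using \<alpha> by (simp add: field_simps power2_eq_square)
  thus ?thesis using m \<alpha> by (simp add: multiplier_def)
qed

text \<open>After multiplication by \<zeta>^k the quotient becomes (1 - \<zeta>^(2k)) \<zeta> / (1 -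
  \<zeta>^2), which is the source of |1 - w^4| in the denominator.\<close>

lemma cheb_bound:
  fixes \<zeta> :: complex
  assumes "\<zeta> \<noteq> 0" "cmod \<zeta> < 1"
  shows "cmod (cheb \<zeta> k) * cmod \<zeta> ^ k \<le> 2 * cmod \<zeta> / cmod (1 - \<zeta>\<^sup>2)"
proof -
  have "cheb \<zeta> k * \<zeta> ^ k = (1 - \<zeta> ^ (2 * k)) / (inverse \<zeta> - \<zeta>)"
  proof -
    have "inverse \<zeta> ^ k * \<zeta> ^ k = 1"
      using assms by (simp flip: power_mult_distrib)
    thus ?thesis by (simp add: cheb_def left_diff_distrib mult_2 power_add)
  qed
  also have "inverse \<zeta> - \<zeta> = (1 - \<zeta>\<^sup>2) / \<zeta>"
    using assms by (simp add: field_simps power2_eq_square)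
  also have "(1 - \<zeta> ^ (2 * k)) / ((1 - \<zeta>\<^sup>2) / \<zeta>) = (1 - \<zeta> ^ (2 * k)) * \<zeta> / (1 - \<zeta>\<^sup>2)"
    by simp
  finally have "cmod (cheb \<zeta> k * \<zeta> ^ k) = cmod (1 - \<zeta> ^ (2 * k)) * cmod \<zeta> / cmod (1 - \<zeta>\<^sup>2)"
    by (simp add: norm_mult norm_divide)
  moreover have "cmod (1 - \<zeta> ^ (2 * k)) \<le> 2"
  proof -
    have "cmod (1 - \<zeta> ^ (2 * k)) \<le> cmod 1 + cmod (\<zeta> ^ (2 * k))" by (rule norm_triangle_ineq4)
    also have "cmod (\<zeta> ^ (2 * k)) \<le> 1" using assms by (simp add: norm_power power_le_one)
    finally show ?thesis by simp
  qed
  ultimately show ?thesis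
    by (simp add: norm_mult norm_power divide_right_mono mult_right_mono)
qed

lemma phi_even_bound:
  fixes z \<zeta> :: complex
  assumes "\<zeta> \<noteq> 0" "cmod \<zeta> < 1"
  shows "cmod (phi z \<zeta> (2 * k)) * cmod \<zeta> ^ k \<le> cmod (z - p) / \<alpha> * (2 * cmod \<zeta> / cmod (1 - \<zeta>\<^sup>2))"
proof -
  have "cmod (phi z \<zeta> (2 * k)) * cmod \<zeta> ^ k = cmod (z - p) / \<alpha> * (cmod (cheb \<zeta> k) * cmod \<zeta> ^ k)"
    using \<alpha> unfolding phi_even by (simp add: norm_mult norm_divide)
  also have "\<dots> \<le> cmod (z - p) / \<alpha> * (2 * cmod \<zeta> / cmod (1 - \<zeta>\<^sup>2))"
    using \<alpha> by (intro mult_left_mono cheb_bound assms) auto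
  finally show ?thesis .
qed

lemma phi_odd_bound:
  fixes z \<zeta> :: complex
  assumes "\<zeta> \<noteq> 0" "cmod \<zeta> < 1"
  shows "cmod (phi z \<zeta> (2 * k + 1)) * cmod \<zeta> ^ k \<le> (\<alpha> + \<beta>) / \<alpha> * (2 / cmod (1 - \<zeta>\<^sup>2))"
proof -
  define D where "D = cmod (1 - \<zeta>\<^sup>2)"
  have D: "D > 0" using one_minus_sq_nonzero[OF assms(2)] by (simp add: D_def)
  have 1: "cmod (cheb \<zeta> (k + 1)) * cmod \<zeta> ^ k \<le> 2 / D"
  proof -
    have "(cmod (cheb \<zeta> (k + 1)) * cmod \<zeta> ^ k) * cmod \<zeta> \<le> 2 / D * cmod \<zeta>"
      using cheb_bound[OF assms, of "k + 1"] by (simp add: D_def mult_ac)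
    thus ?thesis using assms(1) by (simp only: mult_le_cancel_right) auto
  qed
  have 2: "cmod (cheb \<zeta> k) * cmod \<zeta> ^ k \<le> 2 / D"
  proof -
    have "2 * cmod \<zeta> / D \<le> 2 / D" using assms D by (simp add: divide_right_mono)
    thus ?thesis using cheb_bound[OF assms, of k] by (simp add: D_def)
  qed
  have "cmod (phi z \<zeta> (2 * k + 1)) \<le> cmod (cheb \<zeta> (k + 1)) + \<beta> / \<alpha> * cmod (cheb \<zeta> k)"
    unfolding phi_odd using \<alpha> \<beta> by (intro order_trans[OF norm_triangle_ineq]) (simp add: norm_mult norm_divide)
  hence "cmod (phi z \<zeta> (2 * k + 1)) * cmod \<zeta> ^ k
      \<le> (cmod (cheb \<zeta> (k + 1)) + \<beta> / \<alpha> * cmod (cheb \<zeta> k)) * cmod \<zeta> ^ k"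
    by (intro mult_right_mono) auto
  also have "\<dots> = cmod (cheb \<zeta> (k + 1)) * cmod \<zeta> ^ k + \<beta> / \<alpha> * (cmod (cheb \<zeta> k) * cmod \<zeta> ^ k)"
    by (simp add: algebra_simps)
  also have "\<dots> \<le> 2 / D + \<beta> / \<alpha> * (2 / D)"
    using \<alpha> \<beta> by (intro add_mono mult_left_mono 1 2) auto
  also have "\<dots> = (\<alpha> + \<beta>) / \<alpha> * (2 / D)" using \<alpha> D by (simp add: field_simps)
  finally show ?thesis by (simp add: D_def)
qed

text \<open>The four conditions on M belong to the parities of (n, m) in the order even-even,
  odd-odd, even-odd, odd-even. In each case one factor \<rho> = |w| remains besides \<rho>^(m - n);
  it is the |w| in the numerator of the final inequality.\<close>

lemma phi_psi_bound:
  fixes \<zeta> z :: complex and M \<rho> :: real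
  defines "\<rho> \<equiv> sqrt (cmod \<zeta>)"
  assumes \<zeta>: "\<zeta> \<noteq> 0" "cmod \<zeta> < 1"
    and M: "cmod (z - p) * cmod (\<alpha> + \<beta> * \<zeta>) * \<rho> \<le> \<alpha> * M"
      "(\<alpha> + \<beta>) * cmod (z - r) * \<rho> \<le> \<alpha> * M"
      "cmod (z - p) * cmod (z - r) * cmod \<zeta> \<le> \<alpha> * M"
      "(\<alpha> + \<beta>) * cmod (\<alpha> + \<beta> * \<zeta>) \<le> \<alpha> * M"
    and nm: "n \<le> m"
  shows "cmod (phi z \<zeta> n * psi z \<zeta> m) \<le> 2 * M * \<rho> / cmod (1 - \<zeta>\<^sup>2) * \<rho> ^ (m - n)"
proof -
  define D where "D = cmod (1 - \<zeta>\<^sup>2)"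
  have D: "D > 0" using one_minus_sq_nonzero[OF \<zeta>(2)] by (simp add: D_def)
  have \<rho>: "\<rho> > 0" "cmod \<zeta> = \<rho>\<^sup>2" using \<zeta> by (auto simp: \<rho>_def)
  have scale: "x / \<alpha> * (2 * u / D) \<le> M * (2 * u / D)" if "x \<le> \<alpha> * M" "u \<ge> 0" for x u
    using that \<alpha> D by (intro mult_right_mono) (auto simp: field_simps)
  show ?thesis
  proof (cases "even n")
    case True
    then obtain k where n: "n = 2 * k" by (elim evenE)
    note pb = phi_even_bound[OF \<zeta>, of z k, folded D_def]
    show ?thesis
    proof (cases "even m")
      case True
      then obtain l where m: "m = 2 * l" by (elim evenE)
      define j where "j = l - k"
      have l: "l = k + j" using nm n m by (simp add: j_def)
      have "cmod (phi z \<zeta> n * psi z \<zeta> m) = (cmod (phi z \<zeta> (2 * k)) * cmod \<zeta> ^ k) * (cmod (\<alpha> + \<beta> * \<zeta>) * cmod \<zeta> ^ j)"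
        unfolding n m psi_even l by (simp add: norm_mult norm_power power_add)
      also have "\<dots> \<le> (cmod (z - p) / \<alpha> * (2 * cmod \<zeta> / D)) * (cmod (\<alpha> + \<beta> * \<zeta>) * cmod \<zeta> ^ j)"
        by (intro mult_right_mono pb) auto
      also have "\<dots> = (cmod (z - p) * cmod (\<alpha> + \<beta> * \<zeta>) * \<rho>) / \<alpha> * (2 * (\<rho> * \<rho> ^ (2 * j)) / D)"
        unfolding \<rho>(2) by (simp add: power_mult power_mult_distrib power2_eq_square mult_ac)
      also have "\<dots> \<le> M * (2 * (\<rho> * \<rho> ^ (2 * j)) / D)"
        using \<rho> by (intro scale M) auto
      finally show ?thesis unfolding D_def[symmetric] n m l by (simp add: mult_ac)
    next
      case False
      then obtain l where m: "m = 2 * l + 1" by (elim oddE)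
      define j where "j = l - k"
      have l: "l = k + j" using nm n m by (simp add: j_def)
      have "cmod (phi z \<zeta> n * psi z \<zeta> m) = (cmod (phi z \<zeta> (2 * k)) * cmod \<zeta> ^ k) * (cmod (z - r) * cmod \<zeta> ^ (j + 1))"
        unfolding n m psi_odd l by (simp add: norm_mult norm_power power_add)
      also have "\<dots> \<le> (cmod (z - p) / \<alpha> * (2 * cmod \<zeta> / D)) * (cmod (z - r) * cmod \<zeta> ^ (j + 1))"
        by (intro mult_right_mono pb) auto
      also have "\<dots> = (cmod (z - p) * cmod (z - r) * cmod \<zeta>) / \<alpha> * (2 * (\<rho> ^ (2 * j + 2)) / D)"
        unfolding \<rho>(2) by (simp add: power_mult power_mult_distrib power2_eq_square mult_ac)
      also have "\<dots> \<le> M * (2 * (\<rho> ^ (2 * j + 2)) / D)"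
        using \<rho> by (intro scale M) auto
      finally show ?thesis unfolding D_def[symmetric] n m l by (simp add: mult_ac)
    qed
  next
    case False
    then obtain k where n: "n = 2 * k + 1" by (elim oddE)
    note pb = phi_odd_bound[OF \<zeta>, of z k, folded D_def]
    show ?thesis
    proof (cases "even m")
      case True
      then obtain l where m: "m = 2 * l" by (elim evenE)
      \<comment> \<open>From 2k + 1 \<le> 2l follows l \<ge> k + 1, so the distance m - n is 2j +
        1.\<close>
      define j where "j = l - Suc k"
      have l: "l = k + Suc j" using nm n m by (simp add: j_def)
      have "cmod (phi z \<zeta> n * psi z \<zeta> m) = (cmod (phi z \<zeta> (2 * k + 1)) * cmod \<zeta> ^ k) * (cmod (\<alpha> + \<beta> * \<zeta>) * cmod \<zeta> ^ (j + 1))"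
        unfolding n m psi_even l by (simp add: norm_mult norm_power power_add)
      also have "\<dots> \<le> ((\<alpha> + \<beta>) / \<alpha> * (2 / D)) * (cmod (\<alpha> + \<beta> * \<zeta>) * cmod \<zeta> ^ (j + 1))"
        by (intro mult_right_mono pb) auto
      also have "\<dots> = ((\<alpha> + \<beta>) * cmod (\<alpha> + \<beta> * \<zeta>)) / \<alpha> * (2 * \<rho> ^ (2 * j + 2) / D)"
        unfolding \<rho>(2) by (simp add: power_mult power_mult_distrib power2_eq_square mult_ac)
      also have "\<dots> \<le> M * (2 * \<rho> ^ (2 * j + 2) / D)"
        using \<rho> by (intro scale M) auto
      also have "\<dots> = 2 * M * \<rho> / D * \<rho> ^ (2 * j + 1)" by simp
      finally show ?thesis unfolding D_def[symmetric] n m l by (simp add: mult_ac)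
    next
      case False
      then obtain l where m: "m = 2 * l + 1" by (elim oddE)
      define j where "j = l - k"
      have l: "l = k + j" using nm n m by (simp add: j_def)
      have "cmod (phi z \<zeta> n * psi z \<zeta> m) = (cmod (phi z \<zeta> (2 * k + 1)) * cmod \<zeta> ^ k) * (cmod (z - r) * cmod \<zeta> ^ (j + 1))"
        unfolding n m psi_odd l by (simp add: norm_mult norm_power power_add)
      also have "\<dots> \<le> ((\<alpha> + \<beta>) / \<alpha> * (2 / D)) * (cmod (z - r) * cmod \<zeta> ^ (j + 1))"
        by (intro mult_right_mono pb) auto
      also have "\<dots> = ((\<alpha> + \<beta>) * cmod (z - r) * \<rho>) / \<alpha> * (2 * (\<rho> * \<rho> ^ (2 * j)) / D)"
        unfolding \<rho>(2) by (simp add: power_mult power_mult_distrib power2_eq_square mult_ac)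
      also have "\<dots> \<le> M * (2 * (\<rho> * \<rho> ^ (2 * j)) / D)"
        using \<rho> by (intro scale M) auto
      finally show ?thesis unfolding D_def[symmetric] n m l by (simp add: mult_ac)
    qed
  qed
qed

lemma green_pair_phi_psi:
  fixes \<zeta> z :: complex and M \<rho> :: real
  defines "\<rho> \<equiv> sqrt (cmod \<zeta>)"
  assumes m: "multiplier z \<zeta>" and \<zeta>: "cmod \<zeta> < 1" and ne: "\<alpha> + \<beta> * \<zeta> \<noteq> 0"
    and M: "cmod (z - p) * cmod (\<alpha> + \<beta> * \<zeta>) * \<rho> \<le> \<alpha> * M"
      "(\<alpha> + \<beta>) * cmod (z - r) * \<rho> \<le> \<alpha> * M"
      "cmod (z - p) * cmod (z - r) * cmod \<zeta> \<le> \<alpha> * M"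
      "(\<alpha> + \<beta>) * cmod (\<alpha> + \<beta> * \<zeta>) \<le> \<alpha> * M"
  shows "green_pair (\<lambda>n. of_real (a0 n)) (\<lambda>n. of_real (b0 n)) z (phi z \<zeta>) (psi z \<zeta>)
           (- (\<beta> * (\<alpha> + \<beta> * \<zeta>))) (2 * M * \<rho> / cmod (1 - \<zeta>\<^sup>2)) \<rho>"
proof
  have nz: "\<zeta> \<noteq> 0" using m by (simp add: multiplier_def)
  show "phi z \<zeta> 0 = 0" using phi_even[of z \<zeta> 0] by simp
  show phi1: "phi z \<zeta> 1 = 1" using phi_odd[of z \<zeta> 0] nz \<zeta> by simp
  show "wronskian (\<lambda>n. of_real (a0 n)) (phi z \<zeta>) (psi z \<zeta>) 0 = - (\<beta> * (\<alpha> + \<beta> * \<zeta>))"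
    using phi1 \<open>phi z \<zeta> 0 = 0\<close> psi_even[of z \<zeta> 0] by (simp add: wronskian_def a0_zero algebra_simps)
  show "- (\<beta> * (\<alpha> + \<beta> * \<zeta>)) \<noteq> 0" using ne \<beta> by simp
  show "0 < \<rho>" "\<rho> < 1" using nz \<zeta> by (auto simp: \<rho>_def)
  show "cmod (phi z \<zeta> n * psi z \<zeta> k) \<le> 2 * M * \<rho> / cmod (1 - \<zeta>\<^sup>2) * \<rho> ^ (k - n)"
    if "n \<ge> 1" "n \<le> k" for n k
    using phi_psi_bound[OF nz \<zeta> M[unfolded \<rho>_def] that(2)] unfolding \<rho>_def .
qed (use tau_phi[OF m] tau_psi[OF m] in \<open>auto simp: tau_def\<close>)

end

section \<open>The continuous spectrum determines the band edges\<close>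

text \<open>The quadratic form E is conserved along the recurrence and is positive definite because
  |\<Delta>| < 2. If x tends to 0, so does E, hence E is 0 throughout.\<close>

lemma bounded_three_term_solution_trivial:
  fixes x :: "nat \<Rightarrow> complex" and \<Delta> :: real
  assumes \<Delta>: "\<bar>\<Delta>\<bar> < 2" and rec: "\<And>k. x (k + 2) + x k = \<Delta> *\<^sub>R x (k + 1)" and lim: "x \<longlonglongrightarrow> 0"
  shows "x k = 0"
proof -
  define E where "E = (\<lambda>k. x (k + 1) \<bullet> x (k + 1) + x k \<bullet> x k - \<Delta> * (x (k + 1) \<bullet> x k))"
  have "E (Suc k) = E k" for k
  proof -
    have x: "x (k + 2) = \<Delta> *\<^sub>R x (k + 1) - x k" using rec[of k] by (simp add: eq_diff_eq)
    have "E (Suc k) = x (k + 2) \<bullet> x (k + 2) + x (k + 1) \<bullet> x (k + 1) - \<Delta> * (x (k + 2) \<bullet> x (k + 1))"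
      by (simp add: E_def)
    also have "\<dots> = E k"
      unfolding x E_def by (simp add: inner_diff_left inner_diff_right inner_commute algebra_simps)
    finally show ?thesis .
  qed
  hence E0: "E k = E 0" for k by (induction k) auto
  have "E \<longlonglongrightarrow> (0 :: complex) \<bullet> 0 + (0 :: complex) \<bullet> 0 - \<Delta> * (0 \<bullet> (0 :: complex))"
    unfolding E_def by (intro tendsto_intros LIMSEQ_ignore_initial_segment[OF lim, of 1] lim)
  moreover have "E = (\<lambda>_. E k)"
  proof
    show "E j = E k" for j using E0[of j] E0[of k] by (rule trans[OF _ sym])
  qed
  ultimately have "(\<lambda>_. E k) \<longlonglongrightarrow> 0" by simp
  hence "E k = 0" by (simp add: LIMSEQ_const_iff)
  moreover have "(1 - \<bar>\<Delta>\<bar> / 2) * (cmod (x k))\<^sup>2 \<le> E k"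
  proof -
    have "2 * \<bar>x (k + 1) \<bullet> x k\<bar> \<le> (cmod (x (k + 1)))\<^sup>2 + (cmod (x k))\<^sup>2"
      using Cauchy_Schwarz_ineq2[of "x (k + 1)" "x k"] sum_squares_bound[of "cmod (x (k + 1))" "cmod (x k)"]
      by linarith
    hence "\<bar>\<Delta>\<bar> / 2 * (2 * \<bar>x (k + 1) \<bullet> x k\<bar>) \<le> \<bar>\<Delta>\<bar> / 2 * ((cmod (x (k + 1)))\<^sup>2 + (cmod (x k))\<^sup>2)"
      by (intro mult_left_mono) auto
    moreover have "\<Delta> * (x (k + 1) \<bullet> x k) \<le> \<bar>\<Delta>\<bar> / 2 * (2 * \<bar>x (k + 1) \<bullet> x k\<bar>)"
      using abs_ge_self[of "\<Delta> * (x (k + 1) \<bullet> x k)"] by (simp add: abs_mult)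
    moreover have "0 \<le> (1 - \<bar>\<Delta>\<bar> / 2) * (cmod (x (k + 1)))\<^sup>2" using \<Delta> by simp
    ultimately show ?thesis
      unfolding E_def power2_norm_eq_inner by (simp add: algebra_simps)
  qed
  ultimately have "(1 - \<bar>\<Delta>\<bar> / 2) * (cmod (x k))\<^sup>2 \<le> 0" by simp
  thus ?thesis using \<Delta> by (simp add: mult_le_0_iff)
qed

text \<open>The two roots u + sqrt(u^2 - 1) and u - sqrt(u^2 - 1) have product 1. If one were on the
  unit circle, they would be complex conjugate and u would be real in [-1, 1].\<close>

lemma small_root_exists:
  fixes u :: complex
  assumes "u \<notin> complex_of_real ` {-1..1}"
  shows "\<exists>\<zeta>. \<zeta> \<noteq> 0 \<and> cmod \<zeta> < 1 \<and> \<zeta> + inverse \<zeta> = 2 * u"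
proof -
  define x where "x = u + csqrt (u\<^sup>2 - 1)"
  define y where "y = u - csqrt (u\<^sup>2 - 1)"
  have "x * y = u\<^sup>2 - (csqrt (u\<^sup>2 - 1))\<^sup>2" by (simp add: x_def y_def power2_eq_square algebra_simps)
  hence xy: "x * y = 1" by simp
  have nz: "x \<noteq> 0" "y \<noteq> 0" using xy by auto
  have inv: "inverse x = y" "inverse y = x"
    using xy by (auto simp: inverse_unique mult.commute)
  have sum: "x + y = 2 * u" by (simp add: x_def y_def)
  have "cmod x \<noteq> 1"
  proof
    assume 1: "cmod x = 1"
    hence "y = cnj x" using inv complex_div_cnj[of 1 x] by (simp add: divide_inverse)
    hence "2 * u = of_real (2 * Re x)" using sum complex_add_cnj by metis
    hence "u = of_real (Re x)" by simp
    moreover have "\<bar>Re x\<bar> \<le> 1" using abs_Re_le_cmod[of x] 1 by simp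
    ultimately show False using assms by (auto simp: abs_le_iff)
  qed
  moreover have "cmod x * cmod y = 1" using xy by (metis norm_mult norm_one)
  ultimately have "cmod x < 1 \<or> cmod y < 1"
    by (metis linorder_less_linear mult.right_neutral mult_less_cancel_left_pos
        norm_ge_zero order_le_less zero_less_one mult_zero_left not_less_iff_gr_or_eq)
  thus ?thesis
    using nz inv sum by (metis add.commute)
qed

lemma small_root_unique:
  fixes \<zeta> \<eta> :: complex
  assumes "\<zeta> \<noteq> 0" "cmod \<zeta> < 1" "\<eta> \<noteq> 0" "cmod \<eta> < 1" "\<zeta> + inverse \<zeta> = \<eta> + inverse \<eta>"
  shows "\<zeta> = \<eta>"
proof (rule ccontr)
  assume ne: "\<zeta> \<noteq> \<eta>"
  have "(\<zeta> - \<eta>) * (\<zeta> * \<eta> - 1) = 0"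
    using assms by (simp add: field_simps)
  hence "\<zeta> * \<eta> = 1" using ne by simp
  hence "cmod \<zeta> * cmod \<eta> = 1" by (metis norm_mult norm_one)
  moreover have "cmod \<zeta> * cmod \<eta> < 1 * 1"
    using assms by (intro mult_strict_mono) auto
  ultimately show False by simp
qed

text \<open>The spectrum is compared only at points strictly inside or outside the bands and away
  from a finite set F, since the edges and p, r are left undecided. Endpoints are still determined:
  if two of them differed, the interval between them would contain a point that can be
  tested.\<close>

lemma symmetric_bands_eq:
  fixes s d S D m :: real
  assumes sd: "0 < s" "s < d" and SD: "0 \<le> S" "S < D" and F: "finite F"
    and ins: "\<And>x. S < \<bar>x - m\<bar> \<Longrightarrow> \<bar>x - m\<bar> < D \<Longrightarrow> s \<le> \<bar>x\<bar> \<and> \<bar>x\<bar> \<le> d"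
    and out: "\<And>x. x \<notin> F \<Longrightarrow> \<bar>x - m\<bar> > D \<or> \<bar>x - m\<bar> < S \<Longrightarrow> \<not> (s \<le> \<bar>x\<bar> \<and> \<bar>x\<bar> \<le> d)"
  shows "m = 0" "S = s" "D = d"
proof -
  have pick: "\<exists>x. a < x \<and> x < b \<and> x \<notin> F" if "a < b" for a b :: real
  proof -
    have "infinite ({a<..<b} - F)" using infinite_Ioo[OF that] F by (rule Diff_infinite_finite[rotated])
    hence "{a<..<b} - F \<noteq> {}" by (metis finite.emptyI)
    thus ?thesis by auto
  qed
  have 1: "m + D \<le> d"
  proof (rule ccontr)
    assume "\<not> ?thesis"
    hence "max (m + S) d < m + D" using SD by simp
    from pick[OF this] obtain x where "max (m + S) d < x" "x < m + D" by auto
    thus False using ins[of x] SD sd by auto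
  qed
  have 2: "D - m \<le> d"
  proof (rule ccontr)
    assume "\<not> ?thesis"
    hence "m - D < min (m - S) (- d)" using SD by simp
    from pick[OF this] obtain x where "m - D < x" "x < min (m - S) (- d)" by auto
    thus False using ins[of x] SD sd by auto
  qed
  have 3: "m + D \<ge> d"
  proof (rule ccontr)
    assume "\<not> ?thesis"
    hence "max (m + D) s < d" using sd by simp
    from pick[OF this] obtain x where "max (m + D) s < x" "x < d" "x \<notin> F" by auto
    thus False using out[of x] SD sd by auto
  qed
  have 4: "D - m \<ge> d"
  proof (rule ccontr)
    assume "\<not> ?thesis"
    hence "- d < min (m - D) (- s)" using sd by simp
    from pick[OF this] obtain x where "- d < x" "x < min (m - D) (- s)" "x \<notin> F" by auto
    thus False using out[of x] SD sd by auto
  qed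
  show m: "m = 0" and D: "D = d" using 1 2 3 4 by auto
  have "s \<le> S"
  proof (rule ccontr)
    assume "\<not> ?thesis"
    hence "S < s" by simp
    from pick[OF this] obtain x where "S < x" "x < s" by auto
    thus False using ins[of x] SD sd m D by auto
  qed
  moreover have "S \<le> s"
  proof (rule ccontr)
    assume "\<not> ?thesis"
    hence "s < S" by simp
    from pick[OF this] obtain x where "s < x" "x < S" "x \<notin> F" by auto
    thus False using out[of x] SD sd m D by auto
  qed
  ultimately show "S = s" by simp
qed

context periodic_jacobi
begin

text \<open>Eliminating the entries of the other parity from three consecutive rows gives a
  recurrence with constant coefficients; divided by \<alpha> \<beta>, the factor on the right is the
  trace of the monodromy matrix.\<close>

lemma two_step_odd:
  fixes z :: complex and y :: "nat \<Rightarrow> complex"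
  assumes "tau z y (2 * k + 2) = 0" "tau z y (2 * k + 3) = 0" "tau z y (2 * k + 4) = 0"
  shows "\<alpha> * \<beta> * (y (2 * k + 5) + y (2 * k + 1)) = ((z - p) * (z - r) - \<alpha>\<^sup>2 - \<beta>\<^sup>2) * y (2 * k + 3)"
proof -
  have 1: "(z - r) * y (2 * k + 2) = \<alpha> * y (2 * k + 1) + \<beta> * y (2 * k + 3)"
    using assms(1) unfolding tau_even by algebra
  have 2: "(z - p) * y (2 * k + 3) = \<beta> * y (2 * k + 2) + \<alpha> * y (2 * k + 4)"
    using assms(2) tau_odd[of z y "k + 1"] by (simp add: numeral_eq_Suc algebra_simps)
  have 3: "(z - r) * y (2 * k + 4) = \<alpha> * y (2 * k + 3) + \<beta> * y (2 * k + 5)"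
    using assms(3) tau_even[of z y "k + 1"] by (simp add: numeral_eq_Suc algebra_simps)
  have "(z - p) * (z - r) * y (2 * k + 3) = (z - r) * ((z - p) * y (2 * k + 3))" by simp
  also have "\<dots> = \<beta> * ((z - r) * y (2 * k + 2)) + \<alpha> * ((z - r) * y (2 * k + 4))"
    unfolding 2 by (simp add: algebra_simps)
  also have "\<dots> = \<alpha> * \<beta> * (y (2 * k + 5) + y (2 * k + 1)) + (\<alpha>\<^sup>2 + \<beta>\<^sup>2) * y (2 * k + 3)"
    unfolding 1 3 by (simp add: algebra_simps power2_eq_square)
  finally show ?thesis by (simp add: algebra_simps)
qed

lemma two_step_even:
  fixes z :: complex and y :: "nat \<Rightarrow> complex"
  assumes "tau z y (2 * k + 1) = 0" "tau z y (2 * k + 2) = 0" "tau z y (2 * k + 3) = 0"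
  shows "\<alpha> * \<beta> * (y (2 * k + 4) + y (2 * k)) = ((z - p) * (z - r) - \<alpha>\<^sup>2 - \<beta>\<^sup>2) * y (2 * k + 2)"
proof -
  have 1: "(z - p) * y (2 * k + 1) = \<beta> * y (2 * k) + \<alpha> * y (2 * k + 2)"
    using assms(1) unfolding tau_odd by algebra
  have 2: "(z - r) * y (2 * k + 2) = \<alpha> * y (2 * k + 1) + \<beta> * y (2 * k + 3)"
    using assms(2) unfolding tau_even by algebra
  have 3: "(z - p) * y (2 * k + 3) = \<beta> * y (2 * k + 2) + \<alpha> * y (2 * k + 4)"
    using assms(3) tau_odd[of z y "k + 1"] by (simp add: numeral_eq_Suc algebra_simps)
  have "(z - p) * (z - r) * y (2 * k + 2) = (z - p) * ((z - r) * y (2 * k + 2))" by simp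
  also have "\<dots> = \<alpha> * ((z - p) * y (2 * k + 1)) + \<beta> * ((z - p) * y (2 * k + 3))"
    unfolding 2 by (simp add: algebra_simps)
  also have "\<dots> = \<alpha> * \<beta> * (y (2 * k + 4) + y (2 * k)) + (\<alpha>\<^sup>2 + \<beta>\<^sup>2) * y (2 * k + 2)"
    unfolding 1 3 by (simp add: algebra_simps power2_eq_square)
  finally show ?thesis by (simp add: algebra_simps)
qed

definition free_operator :: "(ell2 \<Rightarrow> ell2) \<Rightarrow> bool" where
  "free_operator T \<longleftrightarrow> jacobi_operator (\<lambda>n. of_real (a0 n)) (\<lambda>n. of_real (b0 n)) (\<lambda>n. of_real (a0 n)) T"

lemma coord_free_operator:
  assumes "free_operator T" "n \<ge> 1"
  shows "coord (T y - z *\<^sub>C y) n = tau z (coord y) n"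
  using assms by (simp add: free_operator_def jacobi_operator_def tau_def three_term_def algebra_simps)

lemma surj_off_bands:
  assumes T: "free_operator T" and m: "multiplier z \<zeta>" and \<zeta>: "cmod \<zeta> < 1"
    and ne: "of_real \<alpha> + of_real \<beta> * \<zeta> \<noteq> 0"
  shows "surj (\<lambda>y. T y - z *\<^sub>C y)"
proof -
  define \<rho> where "\<rho> = sqrt (cmod \<zeta>)"
  define x1 where "x1 = cmod (z - p) * cmod (\<alpha> + \<beta> * \<zeta>) * \<rho>"
  define x2 where "x2 = (\<alpha> + \<beta>) * cmod (z - r) * \<rho>"
  define x3 where "x3 = cmod (z - p) * cmod (z - r) * cmod \<zeta>"
  define x4 where "x4 = (\<alpha> + \<beta>) * cmod (\<alpha> + \<beta> * \<zeta>)"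
  \<comment> \<open>Surjectivity needs just some finite constant, so M is taken large enough for all
    four parity conditions at once.\<close>
  define M where "M = (x1 + x2 + x3 + x4) / \<alpha>"
  have "x1 \<ge> 0" "x2 \<ge> 0" "x3 \<ge> 0" "x4 \<ge> 0"
    using \<alpha> \<beta> by (auto simp: x1_def x2_def x3_def x4_def \<rho>_def)
  hence "x1 \<le> \<alpha> * M" "x2 \<le> \<alpha> * M" "x3 \<le> \<alpha> * M" "x4 \<le> \<alpha> * M"
    using \<alpha> by (auto simp: M_def)
  hence g: "green_pair (\<lambda>n. of_real (a0 n)) (\<lambda>n. of_real (b0 n)) z (phi z \<zeta>) (psi z \<zeta>)
           (- (\<beta> * (\<alpha> + \<beta> * \<zeta>))) (2 * M * \<rho> / cmod (1 - \<zeta>\<^sup>2)) \<rho>"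
    unfolding \<rho>_def x1_def x2_def x3_def x4_def
    using green_pair_phi_psi[OF m \<zeta> ne, of M] by simp
  have "\<exists>y. f = T y - z *\<^sub>C y" for f
  proof -
    obtain y where y: "y 0 = 0" "summable (\<lambda>n. (cmod (y n))\<^sup>2)" "\<And>n. n \<ge> 1 \<Longrightarrow> tau z y n = coord f n"
      using green_pair.inhomogeneous_solution[OF g summable_coord[of f]] unfolding tau_def by blast
    have c: "coord (Abs_ell2 y) = y" using y by (intro Abs_ell2_inverse) auto
    have "f = T (Abs_ell2 y) - z *\<^sub>C Abs_ell2 y"
      by (rule ell2_eqI) (simp only: coord_free_operator[OF T] c y)
    thus ?thesis by blast
  qed
  thus ?thesis by (simp add: surj_def)
qed

text \<open>The first row is exempt on purpose: the lemma then gives injectivity and also shows that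
  the first unit vector has no preimage, as a preimage would solve all rows from the second
  on.\<close>

lemma decaying_solution_trivial_in_bands:
  fixes x :: real
  assumes in_band: "\<bar>(x - p) * (x - r) - \<alpha>\<^sup>2 - \<beta>\<^sup>2\<bar> < 2 * (\<alpha> * \<beta>)"
    and y: "\<And>n. n \<ge> 2 \<Longrightarrow> tau (of_real x) (coord y) n = 0"
  shows "y = 0"
proof -
  define \<Delta> where "\<Delta> = ((x - p) * (x - r) - \<alpha>\<^sup>2 - \<beta>\<^sup>2) / (\<alpha> * \<beta>)"
  have ab: "\<alpha> * \<beta> > 0" using \<alpha> \<beta> by simp
  have \<Delta>: "\<bar>\<Delta>\<bar> < 2"
    unfolding \<Delta>_def abs_divide abs_of_pos[OF ab] using in_band by (subst pos_divide_less_eq[OF ab])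
  have conv: "u = \<Delta> *\<^sub>R v"
    if "of_real \<alpha> * of_real \<beta> * u = ((of_real x - of_real p) * (of_real x - of_real r)
          - (of_real \<alpha>)\<^sup>2 - (of_real \<beta>)\<^sup>2) * v" for u v :: complex
  proof -
    have "of_real (\<alpha> * \<beta>) * u = of_real ((x - p) * (x - r) - \<alpha>\<^sup>2 - \<beta>\<^sup>2) * v"
      using that by simp
    also have "(x - p) * (x - r) - \<alpha>\<^sup>2 - \<beta>\<^sup>2 = (\<alpha> * \<beta>) * \<Delta>"
      using \<alpha> \<beta> by (simp add: \<Delta>_def)
    finally have "of_real (\<alpha> * \<beta>) * u = of_real (\<alpha> * \<beta>) * (\<Delta> *\<^sub>R v)"
      by (simp add: scaleR_conv_of_real)
    thus ?thesis using ab by (metis mult_left_cancel of_real_eq_0_iff less_irrefl)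
  qed
  have sub: "(\<lambda>k. coord y (2 * k + j)) \<longlonglongrightarrow> 0" for j
    by (rule LIMSEQ_subseq_LIMSEQ[OF coord_tendsto_0, of "\<lambda>k. 2 * k + j", unfolded comp_def])
      (simp add: strict_mono_def)
  have odd: "coord y (2 * k + 1) = 0" for k
  proof (rule bounded_three_term_solution_trivial[OF \<Delta> _ sub[of 1]])
    fix k
    show "coord y (2 * (k + 2) + 1) + coord y (2 * k + 1) = \<Delta> *\<^sub>R coord y (2 * (k + 1) + 1)"
      using two_step_odd[of "of_real x" "coord y" k] y
      by (intro conv) (simp add: numeral_eq_Suc)
  qed
  have even: "coord y (2 * k + 2) = 0" for k
  proof (rule bounded_three_term_solution_trivial[OF \<Delta> _ sub[of 2]])
    fix k
    show "coord y (2 * (k + 2) + 2) + coord y (2 * k + 2) = \<Delta> *\<^sub>R coord y (2 * (k + 1) + 2)"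
      using two_step_even[of "of_real x" "coord y" "k + 1"] y
      by (intro conv) (simp add: numeral_eq_Suc)
  qed
  show "y = 0"
  proof (rule ell2_eqI)
    fix n :: nat assume "n \<ge> 1"
    thus "coord y n = coord 0 n" by (cases rule: parity_cases) (use odd even in auto)
  qed
qed

text \<open>
  The damped Floquet solution \<open>q\<^sup>n psi n\<close> with \<open>q \<rightarrow> 1\<close> is an approximate solution whose only
  non-vanishing residue is the missing boundary term in the first row.
\<close>

lemma unit_vec_1_in_closure_range:
  assumes T: "free_operator T" and m: "multiplier z w" and w: "cmod w = 1"
    and ne: "of_real \<alpha> + of_real \<beta> * w \<noteq> 0"
  shows "unit_vec 1 \<in> closure (range (\<lambda>y. T y - z *\<^sub>C y))"
proof -
  define C where "C = cmod (of_real \<alpha> + of_real \<beta> * w) + cmod (z - r)"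
  \<comment> \<open>Setting the entry at 0 to 0 removes \<open>a0 0 * psi z w 0\<close> from the
    first row, and this is minus that term.\<close>
  define \<kappa> where "\<kappa> = - (of_real \<beta> * (of_real \<alpha> + of_real \<beta> * w))"
  \<comment> \<open>3 = 2 + 1: the neighbour on the left carries the factor 1/q \<le> 2, the one on
    the right carries 1.\<close>
  define K where "K = 3 * (\<alpha> + \<beta>) * C"
  have \<kappa>: "\<kappa> \<noteq> 0" using ne \<beta> by (simp add: \<kappa>_def)
  have psi: "cmod (psi z w n) \<le> C" for n
    using w by (simp add: psi_def C_def norm_mult norm_power)
  have C0: "C \<ge> 0" by (simp add: C_def)
  have K0: "K \<ge> 0" using C0 \<alpha> \<beta> by (simp add: K_def)
  have a0: "\<bar>a0 n\<bar> \<le> \<alpha> + \<beta>" for n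
  proof (cases "even n")
    case True
    thus ?thesis using a0_even[of "n div 2"] \<alpha> \<beta> by simp
  next
    case False
    thus ?thesis using a0_odd[of "n div 2"] \<alpha> \<beta> by simp
  qed
  have "\<exists>y. norm ((T y - z *\<^sub>C y) - unit_vec 1) \<le> K / cmod \<kappa> * sqrt (1 - q)"
    if q: "1 / 2 \<le> q" "q < 1" for q :: real
  proof -
    define y where "y = (\<lambda>n. if n = 0 then 0 else of_real (q ^ n) * psi z w n)"
    define Y where "Y = Abs_ell2 y"
    have "summable (\<lambda>n. (cmod (y n))\<^sup>2)"
    proof (rule summable_comparison_test')
      show "summable (\<lambda>n. C\<^sup>2 * (q\<^sup>2) ^ n)"
        using q by (intro summable_mult summable_geometric) (simp add: power_less_one_iff abs_square_less_1)
      show "norm ((cmod (y n))\<^sup>2) \<le> C\<^sup>2 * (q\<^sup>2) ^ n" if "n \<ge> 0" for n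
      proof -
        have "cmod (y n) \<le> q ^ n * C"
          using psi[of n] q C0 by (auto simp: y_def norm_mult norm_power intro!: mult_left_mono)
        hence "(cmod (y n))\<^sup>2 \<le> (q ^ n * C)\<^sup>2" by (intro power_mono) auto
        thus ?thesis by (simp add: power_mult_distrib power_commutes mult_ac flip: power_mult)
      qed
    qed
    hence cY: "coord Y = y" unfolding Y_def by (intro Abs_ell2_inverse) (auto simp: y_def)
    define R where "R = T Y - z *\<^sub>C Y - \<kappa> *\<^sub>C unit_vec 1"
    have R: "coord R n = of_real (q ^ n) * (of_real ((1 - q) / q) * of_real (a0 (n - 1)) * psi z w (n - 1)
             - of_real (1 - q) * of_real (a0 n) * psi z w (n + 1))" if n: "n \<ge> 1" for n
    proof -
      have e: "of_real (b0 n) * psi z w n - z * psi z w n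
          = - (of_real (a0 (n - 1)) * psi z w (n - 1)) - of_real (a0 n) * psi z w (n + 1)"
        using tau_psi[OF m n] by (simp add: tau_def three_term_def algebra_simps add_eq_0_iff)
      have qn: "of_real (q ^ n) * (of_real ((1 - q) / q) :: complex) = of_real (q ^ (n - 1)) - of_real (q ^ n)"
        using q n by (cases n) (auto simp: field_simps)
      have "coord R n = tau z y n - \<kappa> * coord (unit_vec 1) n"
        unfolding R_def using coord_free_operator[OF T n, of Y z] by (simp add: cY)
      also have "\<dots> = of_real (a0 (n - 1)) * (of_real (q ^ (n - 1)) * psi z w (n - 1))
           + of_real (q ^ n) * (of_real (b0 n) * psi z w n - z * psi z w n)
           + of_real (a0 n) * (of_real (q ^ (n + 1)) * psi z w (n + 1))"
      proof (cases "n = 1")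
        case True
        have "psi z w 0 = of_real \<alpha> + of_real \<beta> * w" using psi_even[of z w 0] by simp
        thus ?thesis using True
          by (simp add: tau_def three_term_def y_def coord_unit_vec \<kappa>_def a0_zero algebra_simps)
      next
        case False
        thus ?thesis using n
          by (simp add: tau_def three_term_def y_def coord_unit_vec algebra_simps)
      qed
      also have "\<dots> = (of_real (q ^ (n - 1)) - of_real (q ^ n)) * (of_real (a0 (n - 1)) * psi z w (n - 1))
           - of_real (q ^ n) * (of_real (1 - q) * of_real (a0 n) * psi z w (n + 1))"
        unfolding e by (simp add: algebra_simps)
      finally show ?thesis unfolding qn[symmetric] by (simp add: algebra_simps)
    qed
    have Rb: "cmod (coord R n) \<le> K * (1 - q) * q ^ n" for n
    proof (cases "n = 0")
      case True
      thus ?thesis using K0 q by simp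
    next
      case False
      hence n: "n \<ge> 1" by simp
      have "cmod (of_real ((1 - q) / q) * of_real (a0 (n - 1)) * psi z w (n - 1)
             - of_real (1 - q) * of_real (a0 n) * psi z w (n + 1))
          \<le> (1 - q) / q * \<bar>a0 (n - 1)\<bar> * cmod (psi z w (n - 1)) + (1 - q) * \<bar>a0 n\<bar> * cmod (psi z w (n + 1))"
        using q by (intro order_trans[OF norm_triangle_ineq4]) (simp add: norm_mult del: of_real_diff of_real_divide)
      also have "\<dots> \<le> (2 * (1 - q)) * (\<alpha> + \<beta>) * C + (1 - q) * (\<alpha> + \<beta>) * C"
      proof -
        have "(1 - q) * (1 / q) \<le> (1 - q) * 2" using q by (intro mult_left_mono) (auto simp: field_simps)
        thus ?thesis
          using q C0 \<alpha> \<beta> by (intro add_mono mult_mono a0 psi) auto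
      qed
      also have "\<dots> = K * (1 - q)" by (simp add: K_def algebra_simps)
      finally have "q ^ n * cmod (of_real ((1 - q) / q) * of_real (a0 (n - 1)) * psi z w (n - 1)
             - of_real (1 - q) * of_real (a0 n) * psi z w (n + 1)) \<le> q ^ n * (K * (1 - q))"
        using q by (intro mult_left_mono) auto
      moreover have "\<bar>q ^ n\<bar> = q ^ n" using q by simp
      ultimately show ?thesis using False
        unfolding R[OF n] norm_mult[of "of_real (q ^ n)"] norm_of_real
        by (simp only: mult_ac)
    qed
    \<comment> \<open>The residue has size 1 - q but length about 1/(1 - q), so its squared norm is
      of order (1 - q)^2 / (1 - q^2), which still tends to 0.\<close>
    have "(norm R)\<^sup>2 \<le> (\<Sum>n. (K * (1 - q))\<^sup>2 * (q\<^sup>2) ^ n)"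
      unfolding norm_ell2_sq
    proof (rule suminf_le)
      show "summable (\<lambda>n. (K * (1 - q))\<^sup>2 * (q\<^sup>2) ^ n)"
        using q by (intro summable_mult summable_geometric) (simp add: abs_square_less_1)
      show "(cmod (coord R n))\<^sup>2 \<le> (K * (1 - q))\<^sup>2 * (q\<^sup>2) ^ n" for n
        using power_mono[OF Rb[of n], of 2] by (simp add: power_mult_distrib mult_ac flip: power_mult)
    qed (rule summable_coord)
    also have "\<dots> = (K * (1 - q))\<^sup>2 * (1 / (1 - q\<^sup>2))"
      using q by (subst suminf_mult) (auto simp: abs_square_less_1 suminf_geometric intro!: summable_geometric)
    also have "\<dots> = K\<^sup>2 * (1 - q) * (1 / (1 + q))"
    proof -
      have "1 - q\<^sup>2 = (1 - q) * (1 + q)" by (simp add: power2_eq_square algebra_simps)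
      thus ?thesis using q by (simp add: power2_eq_square)
    qed
    also have "\<dots> \<le> K\<^sup>2 * (1 - q) * 1"
      using q by (intro mult_left_mono) auto
    also have "\<dots> = (K * sqrt (1 - q))\<^sup>2" using q by (simp add: power_mult_distrib)
    finally have Rn: "norm R \<le> K * sqrt (1 - q)"
      by (rule power2_le_imp_le) (use K0 q in auto)
    define V where "V = (1 / \<kappa>) *\<^sub>C Y"
    have "T V - z *\<^sub>C V - unit_vec 1 = (1 / \<kappa>) *\<^sub>C R"
    proof (rule ell2_eqI)
      fix n :: nat assume n: "n \<ge> 1"
      have "coord (T V - z *\<^sub>C V - unit_vec 1) n = tau z (coord V) n - coord (unit_vec 1) n"
        using coord_free_operator[OF T n, of V z] by simp
      also have "tau z (coord V) n = 1 / \<kappa> * tau z (coord Y) n"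
        by (simp add: tau_def three_term_def V_def algebra_simps diff_divide_distrib)
      also have "1 / \<kappa> * tau z (coord Y) n - coord (unit_vec 1) n
          = 1 / \<kappa> * (tau z (coord Y) n - \<kappa> * coord (unit_vec 1) n)"
        using \<kappa> by (simp add: algebra_simps)
      also have "\<dots> = coord ((1 / \<kappa>) *\<^sub>C R) n"
        unfolding R_def using coord_free_operator[OF T n, of Y z] by simp
      finally show "coord (T V - z *\<^sub>C V - unit_vec 1) n = coord ((1 / \<kappa>) *\<^sub>C R) n" .
    qed
    hence "norm (T V - z *\<^sub>C V - unit_vec 1) = norm R / cmod \<kappa>"
      by (simp add: norm_scaleC norm_divide)
    also have "\<dots> \<le> K * sqrt (1 - q) / cmod \<kappa>" using Rn by (intro divide_right_mono) auto
    finally show ?thesis by (intro exI[of _ V]) simp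
  qed
  note approx = this
  define qs where "qs = (\<lambda>k::nat. 1 - 1 / (real k + 2))"
  have "\<exists>y. norm ((T y - z *\<^sub>C y) - unit_vec 1) \<le> K / cmod \<kappa> * sqrt (1 - qs k)" for k
    by (rule approx) (auto simp: qs_def field_simps)
  then obtain Y where Y: "\<And>k. norm ((T (Y k) - z *\<^sub>C Y k) - unit_vec 1) \<le> K / cmod \<kappa> * sqrt (1 - qs k)"
    by metis
  have lim: "(\<lambda>k. K / cmod \<kappa> * sqrt (1 - qs k)) \<longlonglongrightarrow> 0"
  proof -
    have "(\<lambda>k. 1 / (real k + 2)) \<longlonglongrightarrow> 0"
      using LIMSEQ_ignore_initial_segment[OF lim_1_over_n[where 'a = real], of 2] by (simp add: add.commute)
    hence "(\<lambda>k. K / cmod \<kappa> * sqrt (1 / (real k + 2))) \<longlonglongrightarrow> K / cmod \<kappa> * sqrt 0"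
      by (intro tendsto_mult_left tendsto_real_sqrt)
    thus ?thesis by (simp add: qs_def)
  qed
  have "(\<lambda>k. (T (Y k) - z *\<^sub>C Y k) - unit_vec 1) \<longlonglongrightarrow> 0"
    by (rule Lim_null_comparison[OF _ lim]) (use Y in auto)
  hence "(\<lambda>k. T (Y k) - z *\<^sub>C Y k) \<longlonglongrightarrow> unit_vec 1"
    by (rule LIM_zero_cancel)
  thus ?thesis unfolding closure_sequential by (intro exI[of _ "\<lambda>k. T (Y k) - z *\<^sub>C Y k"]) auto
qed

lemma in_continuous_spectrum:
  fixes x :: real
  assumes T: "free_operator T" and in_band: "\<bar>(x - p) * (x - r) - \<alpha>\<^sup>2 - \<beta>\<^sup>2\<bar> < 2 * (\<alpha> * \<beta>)"
  shows "of_real x \<in> continuous_spectrum T"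
proof -
  define z where "z = complex_of_real x"
  define A where "A = (\<lambda>y. T y - z *\<^sub>C y)"
  have ab: "\<alpha> * \<beta> > 0" using \<alpha> \<beta> by simp
  have cA: "coord (A y) n = tau z (coord y) n" if "n \<ge> 1" for y n
    unfolding A_def using coord_free_operator[OF T that] .
  have inj: "inj A"
  proof (rule injI)
    fix u v assume "A u = A v"
    have "u - v = 0"
    proof (rule decaying_solution_trivial_in_bands[OF in_band])
      fix n :: nat assume n: "n \<ge> 2"
      have "tau z (coord (u - v)) n = tau z (coord u) n - tau z (coord v) n"
        by (simp add: tau_def three_term_def algebra_simps)
      also have "\<dots> = 0" using n cA[of n u] cA[of n v] \<open>A u = A v\<close> by simp
      finally show "tau (of_real x) (coord (u - v)) n = 0" by (simp add: z_def)
    qed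
    thus "u = v" by simp
  qed
  have not_surj: "\<not> surj A"
  proof
    assume "surj A"
    then obtain y where y: "unit_vec 1 = A y" by (elim surjE)
    have "y = 0"
    proof (rule decaying_solution_trivial_in_bands[OF in_band])
      fix n :: nat assume "n \<ge> 2"
      thus "tau (of_real x) (coord y) n = 0"
        using cA[of n y] y[symmetric] by (simp add: z_def coord_unit_vec)
    qed
    hence "coord (unit_vec 1) 1 = 0"
      using cA[of 1 y] y by (simp add: tau_def three_term_def)
    thus False by (simp add: coord_unit_vec)
  qed
  define h where "h = ((x - p) * (x - r) - \<alpha>\<^sup>2 - \<beta>\<^sup>2) / (2 * (\<alpha> * \<beta>))"
  have ab2: "2 * (\<alpha> * \<beta>) > 0" using ab by simp
  have h: "\<bar>h\<bar> < 1"
    unfolding h_def abs_divide abs_of_pos[OF ab2] using in_band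
    by (subst pos_divide_less_eq[OF ab2]) simp
  \<comment> \<open>The unimodular multiplier with real part h. As |h| < 1 it is not real, so
    \<alpha> + \<beta> w cannot vanish.\<close>
  define w where "w = Complex h (sqrt (1 - h\<^sup>2))"
  have h2: "h\<^sup>2 < 1" using h by (simp add: abs_square_less_1)
  have w: "cmod w = 1" using h2 by (simp add: w_def cmod_def)
  have "inverse w = cnj w" using complex_div_cnj[of 1 w] w by (simp add: divide_inverse)
  hence ww: "w + inverse w = of_real (2 * h)" by (simp add: complex_add_cnj w_def)
  have "multiplier z w"
  proof -
    have "(x - p) * (x - r) = \<alpha>\<^sup>2 + \<beta>\<^sup>2 + (\<alpha> * \<beta>) * (2 * h)" using \<alpha> \<beta> by (simp add: h_def field_simps)
    hence "of_real ((x - p) * (x - r)) = (of_real (\<alpha>\<^sup>2 + \<beta>\<^sup>2 + (\<alpha> * \<beta>) * (2 * h)) :: complex)" by (rule arg_cong)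
    thus ?thesis using w ww unfolding multiplier_def z_def by auto
  qed
  moreover have "of_real \<alpha> + of_real \<beta> * w \<noteq> 0"
  proof
    assume "of_real \<alpha> + of_real \<beta> * w = 0"
    hence "Im (of_real \<alpha> + of_real \<beta> * w) = 0" by (simp only: zero_complex.sel)
    thus False using \<beta> h2 by (simp add: w_def)
  qed
  ultimately have "unit_vec 1 \<in> closure (range (\<lambda>y. T y - z *\<^sub>C y))"
    using unit_vec_1_in_closure_range[OF T] w by blast
  hence "closure (range (\<lambda>y. T y - z *\<^sub>C y)) = UNIV"
    using T[unfolded free_operator_def] positive
    by (intro dense_range_if_unit_vec_1) (auto simp: less_imp_neq[symmetric])
  thus ?thesis using inj not_surj by (simp add: continuous_spectrum_def A_def z_def)
qed

lemma multiplierI: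
  assumes "\<zeta> \<noteq> 0" "\<zeta> + inverse \<zeta> = ((z - of_real p) * (z - of_real r) - of_real (\<alpha>\<^sup>2 + \<beta>\<^sup>2)) / of_real (\<alpha> * \<beta>)"
  shows "multiplier z \<zeta>"
  using assms \<alpha> \<beta> unfolding multiplier_def by simp

text \<open>Off the bands the shifted operator is onto unless the Wronskian vanishes, and by the
  factored multiplier equation this can happen only at p or r.\<close>

lemma not_in_continuous_spectrum:
  fixes x :: real
  assumes T: "free_operator T" and off_band: "\<bar>(x - p) * (x - r) - \<alpha>\<^sup>2 - \<beta>\<^sup>2\<bar> > 2 * (\<alpha> * \<beta>)"
    and x: "x \<noteq> p" "x \<noteq> r"
  shows "of_real x \<notin> continuous_spectrum T"
proof -
  define z where "z = complex_of_real x"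
  define h where "h = ((x - p) * (x - r) - \<alpha>\<^sup>2 - \<beta>\<^sup>2) / (2 * (\<alpha> * \<beta>))"
  have ab: "\<alpha> * \<beta> > 0" using \<alpha> \<beta> by simp
  have ab2: "2 * (\<alpha> * \<beta>) > 0" using ab by simp
  have h: "\<bar>h\<bar> > 1"
    unfolding h_def abs_divide abs_of_pos[OF ab2] using off_band
    by (subst pos_less_divide_eq[OF ab2]) simp
  hence "complex_of_real h \<notin> complex_of_real ` {-1..1}" by auto
  then obtain \<zeta> :: complex where \<zeta>: "\<zeta> \<noteq> 0" "cmod \<zeta> < 1" "\<zeta> + inverse \<zeta> = 2 * of_real h"
    using small_root_exists by blast
  have m: "multiplier z \<zeta>"
  proof (rule multiplierI[OF \<zeta>(1)])
    have "2 * h = ((x - p) * (x - r) - (\<alpha>\<^sup>2 + \<beta>\<^sup>2)) / (\<alpha> * \<beta>)"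
      using \<alpha> \<beta> by (simp add: h_def field_simps)
    hence "complex_of_real (2 * h) = of_real (((x - p) * (x - r) - (\<alpha>\<^sup>2 + \<beta>\<^sup>2)) / (\<alpha> * \<beta>))"
      by (rule arg_cong)
    thus "\<zeta> + inverse \<zeta> = ((z - of_real p) * (z - of_real r) - of_real (\<alpha>\<^sup>2 + \<beta>\<^sup>2)) / of_real (\<alpha> * \<beta>)"
      using \<zeta>(3) by (simp add: z_def)
  qed
  have "of_real \<alpha> + of_real \<beta> * \<zeta> \<noteq> 0"
  proof
    assume "of_real \<alpha> + of_real \<beta> * \<zeta> = 0"
    hence "(z - of_real p) * (z - of_real r) * \<zeta> = 0" using multiplier_key[OF m] by simp
    thus False using x \<zeta> by (simp add: z_def)
  qed
  hence "surj (\<lambda>y. T y - z *\<^sub>C y)" by (rule surj_off_bands[OF T m \<zeta>(2)])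
  thus ?thesis by (simp add: continuous_spectrum_def z_def)
qed

text \<open>With centre m and half difference \<delta> of the diagonal entries, the trace depends on
  |x - m| only, and the condition that it lies strictly between -2 and 2 reads S < |x - m| <
  D.\<close>

lemma band_edges:
  assumes T: "free_operator T" and sd: "0 < s" "s < d" and spec: "continuous_spectrum T = bands s d"
  shows "r = - p" "d\<^sup>2 = p\<^sup>2 + (\<alpha> + \<beta>)\<^sup>2" "s\<^sup>2 = p\<^sup>2 + (\<alpha> - \<beta>)\<^sup>2"
proof -
  define m where "m = (p + r) / 2"
  define \<delta> where "\<delta> = (p - r) / 2"
  define S where "S = sqrt (\<delta>\<^sup>2 + (\<alpha> - \<beta>)\<^sup>2)"
  define D where "D = sqrt (\<delta>\<^sup>2 + (\<alpha> + \<beta>)\<^sup>2)"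
  have ab: "\<alpha> * \<beta> > 0" using \<alpha> \<beta> by simp
  have S: "S \<ge> 0" "S\<^sup>2 = \<delta>\<^sup>2 + (\<alpha> - \<beta>)\<^sup>2" by (auto simp: S_def)
  have D: "D \<ge> 0" "D\<^sup>2 = \<delta>\<^sup>2 + (\<alpha> + \<beta>)\<^sup>2" by (auto simp: D_def)
  have SD: "S < D" unfolding S_def D_def using ab by (simp add: power2_eq_square algebra_simps)
  have disc: "(x - p) * (x - r) - \<alpha>\<^sup>2 - \<beta>\<^sup>2 = \<bar>x - m\<bar>\<^sup>2 - \<delta>\<^sup>2 - \<alpha>\<^sup>2 - \<beta>\<^sup>2" for x
    by (simp add: m_def \<delta>_def power2_eq_square field_simps)
  have mem: "of_real x \<in> bands s d \<longleftrightarrow> s \<le> \<bar>x\<bar> \<and> \<bar>x\<bar> \<le> d" for x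
    using sd by (auto simp: bands_def abs_if split: if_splits)
  have ins: "s \<le> \<bar>x\<bar> \<and> \<bar>x\<bar> \<le> d" if x: "S < \<bar>x - m\<bar>" "\<bar>x - m\<bar> < D" for x
  proof -
    have "S\<^sup>2 < \<bar>x - m\<bar>\<^sup>2" "\<bar>x - m\<bar>\<^sup>2 < D\<^sup>2"
      using power_strict_mono[OF x(1) S(1), of 2] power_strict_mono[OF x(2) abs_ge_zero, of 2] by simp_all
    hence "\<bar>(x - p) * (x - r) - \<alpha>\<^sup>2 - \<beta>\<^sup>2\<bar> < 2 * (\<alpha> * \<beta>)"
      unfolding disc S(2) D(2) by (simp add: abs_less_iff power2_eq_square algebra_simps)
    from in_continuous_spectrum[OF T this] show ?thesis
      by (simp add: spec mem)
  qed
  have out: "\<not> (s \<le> \<bar>x\<bar> \<and> \<bar>x\<bar> \<le> d)"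
    if x: "x \<notin> {p, r}" "\<bar>x - m\<bar> > D \<or> \<bar>x - m\<bar> < S" for x
  proof -
    have "\<bar>x - m\<bar>\<^sup>2 > D\<^sup>2 \<or> \<bar>x - m\<bar>\<^sup>2 < S\<^sup>2"
      using x(2) D(1) S(1) by (meson abs_ge_zero pos2 power_strict_mono)
    moreover have "S\<^sup>2 = \<delta>\<^sup>2 + \<alpha>\<^sup>2 + \<beta>\<^sup>2 - 2 * (\<alpha> * \<beta>)" "D\<^sup>2 = \<delta>\<^sup>2 + \<alpha>\<^sup>2 + \<beta>\<^sup>2 + 2 * (\<alpha> * \<beta>)"
      unfolding S(2) D(2) by (simp_all add: power2_sum power2_diff)
    ultimately have "\<bar>(x - p) * (x - r) - \<alpha>\<^sup>2 - \<beta>\<^sup>2\<bar> > 2 * (\<alpha> * \<beta>)"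
      unfolding disc by linarith
    from not_in_continuous_spectrum[OF T this] x(1) show ?thesis
      by (simp add: spec mem)
  qed
  have fin: "finite {p, r}" by simp
  have mSD: "m = 0" "S = s" "D = d"
    using symmetric_bands_eq[of s d S D "{p, r}" m, OF sd S(1) SD fin ins out] by blast+
  show r: "r = - p" using mSD(1) by (simp add: m_def)
  have "\<delta> = p" by (simp add: \<delta>_def r)
  thus "d\<^sup>2 = p\<^sup>2 + (\<alpha> + \<beta>)\<^sup>2" "s\<^sup>2 = p\<^sup>2 + (\<alpha> - \<beta>)\<^sup>2"
    using S(2) D(2) mSD by simp_all
qed

end

section \<open>The Floquet multiplier at \<open>\<nu>\<close>\<close>

text \<open>The recurrence factors: D removes the decaying mode \<zeta>^k and is multiplied by
  1/\<zeta> at each step. Being nondecreasing in modulus and null, it vanishes at 0.\<close>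

lemma decaying_three_term_solution_from_0:
  fixes x :: "nat \<Rightarrow> complex"
  assumes \<zeta>: "\<zeta> \<noteq> 0" "cmod \<zeta> < 1" and x0: "x 0 = 0"
    and rec: "\<And>k. x (k + 2) + x k = (\<zeta> + inverse \<zeta>) * x (k + 1)" and lim: "x \<longlonglongrightarrow> 0"
  shows "x k = 0"
proof -
  define D where "D = (\<lambda>k. x (k + 1) - \<zeta> * x k)"
  have D_rec: "\<zeta> * D (Suc k) = D k" for k
  proof -
    have "x (k + 2) = (\<zeta> + inverse \<zeta>) * x (k + 1) - x k"
      using rec[of k] by (simp add: eq_diff_eq)
    thus ?thesis using \<zeta> by (simp add: D_def field_simps)
  qed
  have D_ge: "cmod (D 0) \<le> cmod (D k)" for k
  proof (induction k)
    case (Suc k)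
    have "cmod (D k) = cmod \<zeta> * cmod (D (Suc k))" by (metis D_rec norm_mult)
    also have "\<dots> \<le> 1 * cmod (D (Suc k))" using \<zeta> by (intro mult_right_mono) auto
    finally show ?case using Suc by simp
  qed simp
  have "D \<longlonglongrightarrow> 0 - \<zeta> * 0"
    unfolding D_def by (intro tendsto_intros LIMSEQ_ignore_initial_segment[OF lim, of 1] lim)
  hence "(\<lambda>k. cmod (D k)) \<longlonglongrightarrow> 0" by (simp add: tendsto_norm_zero)
  hence "cmod (D 0) \<le> 0" by (rule LIMSEQ_le_const) (use D_ge in auto)
  hence x1: "x 1 = 0" by (simp add: D_def x0)
  have "x k = 0 \<and> x (Suc k) = 0"
  proof (induction k)
    case (Suc k)
    thus ?case using rec[of k] by simp
  qed (use x0 x1 in simp)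
  thus ?thesis by simp
qed

section \<open>The branch w^2 and its boundary value at an inner band edge\<close>

lemma small_root_eqI:
  assumes "\<zeta> \<noteq> 0" "cmod \<zeta> < 1" "\<zeta> + inverse \<zeta> = 2 * floquet_u s d z"
  shows "small_root s d z = \<zeta>"
  unfolding small_root_def
proof (rule the_equality)
  show "\<eta> = \<zeta>" if "\<eta> \<noteq> 0 \<and> cmod \<eta> < 1 \<and> \<eta> + inverse \<eta> = 2 * floquet_u s d z" for \<eta>
    using small_root_unique[of \<eta> \<zeta>] that assms by simp
qed (use assms in auto)

lemma in_bands_if_floquet_u:
  assumes "0 < s" "s < d" "floquet_u s d z \<in> complex_of_real ` {-1..1}"
  shows "z \<in> bands s d"
proof -
  obtain h where h: "floquet_u s d z = of_real h" "-1 \<le> h" "h \<le> 1" using assms(3) by auto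
  define c where "c = d\<^sup>2 - s\<^sup>2"
  have c: "c > 0" using assms by (simp add: c_def power_strict_mono)
  define X where "X = c * h / 2 + (d\<^sup>2 + s\<^sup>2) / 2"
  have "z\<^sup>2 - of_real ((d\<^sup>2 + s\<^sup>2) / 2) = of_real (c / 2) * floquet_u s d z"
    using c by (simp add: floquet_u_def c_def[symmetric] del: of_real_diff)
  also have "\<dots> = of_real (c * h / 2)" by (simp add: h)
  finally have z2: "z\<^sup>2 = of_real X" by (simp only: X_def of_real_add diff_eq_eq)
  have "c * h \<le> c * 1" "c * (-1) \<le> c * h" using c h by (intro mult_left_mono; simp)+
  hence X: "s\<^sup>2 \<le> X" "X \<le> d\<^sup>2" by (auto simp: X_def c_def field_simps)
  have X0: "X \<ge> 0" using X(1) by (meson order_trans zero_le_power2)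
  have "z\<^sup>2 = (of_real (sqrt X))\<^sup>2" using X0 z2 by (simp flip: of_real_power)
  hence "z = of_real (sqrt X) \<or> z = of_real (- sqrt X)" by (auto simp: power2_eq_iff)
  moreover have "s \<le> sqrt X" "sqrt X \<le> d"
    using X assms by (auto intro: real_le_rsqrt real_le_lsqrt simp: X0)
  ultimately show ?thesis unfolding bands_def by (elim disjE) (rule image_eqI, assumption, simp)+
qed

lemma small_root_props:
  assumes "0 < s" "s < d" "z \<notin> bands s d"
  shows "small_root s d z \<noteq> 0" "cmod (small_root s d z) < 1"
    "small_root s d z + inverse (small_root s d z) = 2 * floquet_u s d z"
proof -
  have "floquet_u s d z \<notin> complex_of_real ` {-1..1}"
    using in_bands_if_floquet_u assms by blast
  then obtain \<zeta> where "\<zeta> \<noteq> 0" "cmod \<zeta> < 1" "\<zeta> + inverse \<zeta> = 2 * floquet_u s d z"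
    using small_root_exists by blast
  thus "small_root s d z \<noteq> 0" "cmod (small_root s d z) < 1"
    "small_root s d z + inverse (small_root s d z) = 2 * floquet_u s d z"
    using small_root_eqI by metis+
qed

text \<open>Continuity up to the edge follows from (\<zeta> + 1)^2 = \<zeta> (2 u + 2) and |\<zeta>|
  < 1, which bound |\<zeta> + 1| by the square root of |2 u + 2|. The lemma serves the degenerate
  case \<alpha> = \<beta>, where \<nu> is itself a band edge.\<close>

lemma w_sq_band_edge:
  assumes sd: "0 < s" "s < d" and z: "z \<in> bands s d" and u: "floquet_u s d z = -1"
  shows "w_sq s d z = -1"
proof -
  let ?F = "at z within {\<mu>. Im \<mu> > 0}"
  have "((\<lambda>\<mu>. small_root s d \<mu> + 1) \<longlongrightarrow> 0) ?F"
  proof (rule Lim_null_comparison)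
    show "\<forall>\<^sub>F \<mu> in ?F. norm (small_root s d \<mu> + 1) \<le> sqrt (cmod (2 * floquet_u s d \<mu> + 2))"
      unfolding eventually_at_filter
    proof (rule always_eventually, safe)
      fix \<mu> :: complex assume "Im \<mu> > 0"
      hence "\<mu> \<notin> bands s d" by (auto simp: bands_def)
      note \<zeta> = small_root_props[OF sd this]
      let ?\<zeta> = "small_root s d \<mu>"
      have "(?\<zeta> + 1)\<^sup>2 = ?\<zeta> * (?\<zeta> + inverse ?\<zeta> + 2)"
        using \<zeta>(1) by (simp add: field_simps power2_eq_square)
      hence "(cmod (?\<zeta> + 1))\<^sup>2 = cmod ?\<zeta> * cmod (2 * floquet_u s d \<mu> + 2)"
        unfolding \<zeta>(3) by (metis norm_mult norm_power)
      also have "\<dots> \<le> 1 * cmod (2 * floquet_u s d \<mu> + 2)"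
        using \<zeta>(2) by (intro mult_right_mono) auto
      finally show "norm (?\<zeta> + 1) \<le> sqrt (cmod (2 * floquet_u s d \<mu> + 2))"
        by (intro real_le_rsqrt) simp
    qed
    have "((\<lambda>\<mu>. sqrt (cmod (2 * floquet_u s d \<mu> + 2))) \<longlongrightarrow> sqrt (cmod (2 * floquet_u s d z + 2))) ?F"
      unfolding floquet_u_def by (intro tendsto_intros)
    thus "((\<lambda>\<mu>. sqrt (cmod (2 * floquet_u s d \<mu> + 2))) \<longlongrightarrow> 0) ?F" by (simp add: u)
  qed
  hence "((\<lambda>\<mu>. (small_root s d \<mu> + 1) - 1) \<longlongrightarrow> 0 - 1) ?F" by (intro tendsto_intros)
  hence lim: "(small_root s d \<longlongrightarrow> -1) ?F" by simp
  have "Im z = 0" using z by (auto simp: bands_def)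
  have "z islimpt {\<mu>. Im \<mu> > 0}"
    unfolding islimpt_approachable
  proof safe
    fix e :: real assume "e > 0"
    thus "\<exists>x'\<in>{\<mu>. 0 < Im \<mu>}. x' \<noteq> z \<and> dist x' z < e"
      using \<open>Im z = 0\<close> by (intro bexI[of _ "z + of_real (e / 2) * \<i>"]) (auto simp: dist_norm norm_mult)
  qed
  hence "Lim ?F (small_root s d) = -1"
    using lim by (intro tendsto_Lim) (auto simp: trivial_limit_within)
  thus ?thesis using z by (simp add: w_sq_def)
qed

text \<open>From here on the spectral hypothesis is represented by the algebraic relations derived
  from it.\<close>

locale two_band_jacobi = periodic_jacobi +
  fixes s d :: real
  assumes sd: "0 < s" "s < d"
    and r_eq: "b0 2 = - b0 1"
    and d_sq: "d\<^sup>2 = (b0 1)\<^sup>2 + (a0 1 + a0 2)\<^sup>2"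
    and s_sq: "s\<^sup>2 = (b0 1)\<^sup>2 + (a0 1 - a0 2)\<^sup>2"
begin

lemma gap_eq: "d\<^sup>2 - s\<^sup>2 = 4 * (\<alpha> * \<beta>)"
  unfolding d_sq s_sq by (simp add: power2_eq_square algebra_simps)

lemma floquet_u_eq:
  "2 * floquet_u s d z = ((z - of_real p) * (z - of_real r) - of_real (\<alpha>\<^sup>2 + \<beta>\<^sup>2)) / of_real (\<alpha> * \<beta>)"
proof -
  have *: "(d\<^sup>2 + s\<^sup>2) / 2 = p\<^sup>2 + \<alpha>\<^sup>2 + \<beta>\<^sup>2"
    unfolding d_sq s_sq by (simp add: power2_eq_square algebra_simps)
  show ?thesis
    unfolding floquet_u_def gap_eq * r_eq using \<alpha> \<beta>
    by (simp add: field_simps power2_eq_square)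
qed

lemma multiplier_floquet:
  "\<zeta> \<noteq> 0 \<Longrightarrow> \<zeta> + inverse \<zeta> = 2 * floquet_u s d z \<Longrightarrow> multiplier z \<zeta>"
  unfolding floquet_u_eq by (rule multiplierI)

lemma floquet_u_p: "2 * floquet_u s d (of_real p) = of_real (- (\<alpha>\<^sup>2 + \<beta>\<^sup>2) / (\<alpha> * \<beta>))"
  unfolding floquet_u_eq by simp

lemma \<alpha>\<beta>_le: "\<alpha> + \<beta> \<le> d" and p_le: "\<bar>p\<bar> \<le> d"
proof -
  show "\<alpha> + \<beta> \<le> d"
    by (rule power2_le_imp_le) (use d_sq sd in auto)
  show "\<bar>p\<bar> \<le> d"
    by (rule power2_le_imp_le) (use d_sq sd in auto)
qed

text \<open>The eigenvector lives on the odd sites, where consecutive entries have ratio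
  -\<alpha>/\<beta>; it is square-summable because \<alpha> < \<beta>.\<close>

lemma eigenvector_p:
  assumes T: "free_operator T" and less: "\<alpha> < \<beta>"
  shows "is_eigenvalue T (of_real p)"
proof -
  define x where "x = - complex_of_real (\<alpha> / \<beta>)"
  define y where "y = (\<lambda>n. if even n then 0 else x ^ (n div 2))"
  have x: "cmod x < 1" "complex_of_real \<alpha> + complex_of_real \<beta> * x = 0"
    using less \<alpha> \<beta> by (auto simp: x_def norm_divide)
  have y_even: "y (2 * k) = 0" and y_odd: "y (2 * k + 1) = x ^ k" for k
    by (auto simp: y_def)
  have "summable (\<lambda>n. (cmod (y n))\<^sup>2)"
  proof (cases "x = 0")
    case True
    thus ?thesis by (intro summable_finite[of "{1}"]) (auto simp: y_def elim!: oddE)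
  next
    case False
    define c where "c = cmod x"
    have c: "0 < c" "c < 1" using x False by (auto simp: c_def)
    show ?thesis
    proof (rule summable_comparison_test')
      show "summable (\<lambda>n. 1 / c * c ^ n)"
        using c by (intro summable_mult summable_geometric) auto
      show "norm ((cmod (y n))\<^sup>2) \<le> 1 / c * c ^ n" if "n \<ge> 0" for n
      proof (cases "even n")
        case True
        thus ?thesis using c by (simp add: y_def)
      next
        case False
        then obtain k where n: "n = 2 * k + 1" by (elim oddE)
        have "(cmod (y n))\<^sup>2 = c ^ (2 * k)"
          unfolding n y_odd by (simp add: norm_power c_def power_mult[symmetric] mult.commute)
        thus ?thesis using c by (simp add: n)
      qed
    qed
  qed
  hence c: "coord (Abs_ell2 y) = y" by (intro Abs_ell2_inverse) (auto simp: y_def)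
  have tau0: "tau (of_real p) y n = 0" if "n \<ge> 1" for n
    using that
  proof (cases rule: parity_cases)
    case (1 k)
    thus ?thesis unfolding 1 tau_odd y_odd using y_even[of k] y_even[of "k + 1"] by simp
  next
    case (2 k)
    have "tau (of_real p) y n = (\<alpha> + \<beta> * x) * x ^ k"
      unfolding 2 tau_even y_odd using y_even[of "k + 1"] y_odd[of "k + 1"]
      by (simp add: numeral_3_eq_3 algebra_simps)
    thus ?thesis using x by simp
  qed
  have "T (Abs_ell2 y) - of_real p *\<^sub>C Abs_ell2 y = 0"
    by (rule ell2_eqI) (simp only: coord_free_operator[OF T] c tau0 coord_zero)
  moreover have "Abs_ell2 y \<noteq> 0"
  proof
    assume "Abs_ell2 y = 0"
    hence "y 1 = 0" using c by (metis coord_zero)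
    thus False using y_odd[of 0] by simp
  qed
  ultimately show ?thesis unfolding is_eigenvalue_def by (intro exI[of _ "Abs_ell2 y"]) simp
qed

text \<open>The even entries start from 0 and tend to 0, hence vanish. The odd entries then have
  ratio -\<alpha>/\<beta>, of modulus at least 1, and can tend to 0 only if they are all 0.\<close>

lemma no_eigenvalue:
  assumes T: "free_operator T" and le: "\<beta> \<le> \<alpha>" and z: "z \<notin> bands s d"
  shows "\<not> is_eigenvalue T z"
proof
  assume "is_eigenvalue T z"
  then obtain y where y: "y \<noteq> 0" "T y = z *\<^sub>C y" by (auto simp: is_eigenvalue_def)
  define \<zeta> where "\<zeta> = small_root s d z"
  note \<zeta> = small_root_props[OF sd z, folded \<zeta>_def]
  have tau0: "tau z (coord y) n = 0" if "n \<ge> 1" for n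
    using coord_free_operator[OF T that, of y z] y(2) by simp
  have sub: "(\<lambda>k. coord y (2 * k + j)) \<longlonglongrightarrow> 0" for j
    by (rule LIMSEQ_subseq_LIMSEQ[OF coord_tendsto_0, of "\<lambda>k. 2 * k + j", unfolded comp_def])
      (simp add: strict_mono_def)
  have even: "coord y (2 * k) = 0" for k
  proof (rule decaying_three_term_solution_from_0[where x = "\<lambda>k. coord y (2 * k)", OF \<zeta>(1,2)])
    show "(\<lambda>k. coord y (2 * k)) \<longlonglongrightarrow> 0" using sub[of 0] by simp
    fix k
    have disc: "(z - of_real p) * (z - of_real r) - (of_real \<alpha>)\<^sup>2 - (of_real \<beta>)\<^sup>2
        = of_real \<alpha> * of_real \<beta> * (\<zeta> + inverse \<zeta>)"
      using multiplier_floquet[OF \<zeta>(1,3)] by (simp add: multiplier_def)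
    have "of_real \<alpha> * of_real \<beta> * (coord y (2 * k + 4) + coord y (2 * k))
        = of_real \<alpha> * of_real \<beta> * ((\<zeta> + inverse \<zeta>) * coord y (2 * k + 2))"
      using two_step_even[of z "coord y" k] tau0
      by (simp add: disc[unfolded One_nat_def] mult.assoc del: mult_cancel_left)
    hence "coord y (2 * k + 4) + coord y (2 * k) = (\<zeta> + inverse \<zeta>) * coord y (2 * k + 2)"
      using \<alpha> \<beta> by simp
    thus "coord y (2 * (k + 2)) + coord y (2 * k) = (\<zeta> + inverse \<zeta>) * coord y (2 * (k + 1))"
      by (simp add: numeral_eq_Suc)
  qed simp
  have odd: "cmod (coord y 1) \<le> cmod (coord y (2 * k + 1))" for k
  proof (induction k)
    case (Suc k)
    have "of_real \<beta> * coord y (2 * k + 3) = - (of_real \<alpha> * coord y (2 * k + 1))"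
      using tau0[of "2 * k + 2"] even[of "k + 1"] unfolding tau_even
      by (simp add: add_eq_0_iff add.commute)
    hence "\<beta> * cmod (coord y (2 * k + 3)) = \<alpha> * cmod (coord y (2 * k + 1))"
      using \<alpha> \<beta> by (metis norm_mult norm_minus_cancel norm_of_real abs_of_pos)
    moreover have "\<beta> * cmod (coord y (2 * k + 1)) \<le> \<alpha> * cmod (coord y (2 * k + 1))"
      using le by (intro mult_right_mono) auto
    ultimately have "cmod (coord y (2 * k + 1)) \<le> cmod (coord y (2 * k + 3))"
      using \<beta> by (metis mult_le_cancel_left_pos)
    thus ?case using Suc by (simp add: numeral_3_eq_3)
  qed simp
  have "(\<lambda>k. cmod (coord y (2 * k + 1))) \<longlonglongrightarrow> 0" using sub[of 1] by (simp add: tendsto_norm_zero)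
  hence "cmod (coord y 1) \<le> 0" by (rule LIMSEQ_le_const) (use odd in auto)
  hence y1: "coord y 1 = 0" by simp
  have "coord y (2 * k + 1) = 0" for k
  proof (induction k)
    case (Suc k)
    have "of_real \<beta> * coord y (2 * k + 3) = - (of_real \<alpha> * coord y (2 * k + 1))"
      using tau0[of "2 * k + 2"] even[of "k + 1"] unfolding tau_even
      by (simp add: add_eq_0_iff add.commute)
    thus ?case using Suc \<beta> by (simp add: numeral_3_eq_3)
  qed (use y1 in simp)
  hence "y = 0"
    using even by (intro ell2_eqI) (metis coord_zero evenE oddE)
  thus False using y by simp
qed

text \<open>At p the equation reads \<zeta> + 1/\<zeta> = -(\<alpha>/\<beta> + \<beta>/\<alpha>). If
  \<alpha> > \<beta> the small root is the inverse of the wanted value, but then there is no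
  eigenvalue in the gap and the exponent is -1. If \<alpha> = \<beta> both sides are -1 for either
  exponent.\<close>

lemma w_sq_p_powi:
  assumes T: "free_operator T"
  shows "w_sq s d (of_real p) powi epsilon T s = - of_real (\<alpha> / \<beta>)"
proof -
  have p_lt: "of_real p \<notin> bands s d" "\<bar>p\<bar> < s" if "\<alpha> \<noteq> \<beta>"
  proof -
    have "\<bar>p\<bar>\<^sup>2 < s\<^sup>2" using that s_sq by simp
    thus "\<bar>p\<bar> < s" using sd by (meson abs_ge_zero less_imp_le power2_less_imp_less)
    thus "of_real p \<notin> bands s d" using sd by (auto simp: bands_def)
  qed
  consider "\<alpha> < \<beta>" | "\<alpha> > \<beta>" | "\<alpha> = \<beta>" by linarith
  thus ?thesis
  proof cases
    case 1
    have "small_root s d (of_real p) = - of_real (\<alpha> / \<beta>)"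
    proof (rule small_root_eqI)
      show "- complex_of_real (\<alpha> / \<beta>) + inverse (- complex_of_real (\<alpha> / \<beta>)) = 2 * floquet_u s d (of_real p)"
      proof -
        have "- (\<alpha> / \<beta>) + inverse (- (\<alpha> / \<beta>)) = - (\<alpha>\<^sup>2 + \<beta>\<^sup>2) / (\<alpha> * \<beta>)"
          using \<alpha> \<beta> by (simp add: field_simps power2_eq_square)
        thus ?thesis unfolding floquet_u_p by (simp flip: of_real_minus of_real_inverse of_real_add del: of_real_divide)
      qed
    qed (use 1 \<alpha> \<beta> in \<open>auto simp: norm_divide\<close>)
    moreover have "epsilon T s = 1"
      using eigenvector_p[OF T 1] p_lt 1 by (auto simp: epsilon_def abs_less_iff intro!: bexI[of _ p])
    ultimately show ?thesis using p_lt 1 by (simp add: w_sq_def)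
  next
    case 2
    have "small_root s d (of_real p) = - of_real (\<beta> / \<alpha>)"
    proof (rule small_root_eqI)
      show "- complex_of_real (\<beta> / \<alpha>) + inverse (- complex_of_real (\<beta> / \<alpha>)) = 2 * floquet_u s d (of_real p)"
      proof -
        have "- (\<beta> / \<alpha>) + inverse (- (\<beta> / \<alpha>)) = - (\<alpha>\<^sup>2 + \<beta>\<^sup>2) / (\<alpha> * \<beta>)"
          using \<alpha> \<beta> by (simp add: field_simps power2_eq_square)
        thus ?thesis unfolding floquet_u_p by (simp flip: of_real_minus of_real_inverse of_real_add del: of_real_divide)
      qed
    qed (use 2 \<alpha> \<beta> in \<open>auto simp: norm_divide\<close>)
    moreover have "epsilon T s = -1"
    proof -
      have "\<not> is_eigenvalue T (of_real x)" if "x \<in> {-s<..<s}" for x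
        by (rule no_eigenvalue[OF T]) (use 2 that in \<open>auto simp: bands_def\<close>)
      thus ?thesis by (auto simp: epsilon_def)
    qed
    ultimately show ?thesis using p_lt 2 by (simp add: w_sq_def power_int_minus)
  next
    case 3
    have "\<bar>p\<bar>\<^sup>2 = s\<^sup>2" using 3 s_sq by simp
    hence "\<bar>p\<bar> = s" using sd by (auto simp: power2_eq_iff)
    hence "of_real p \<in> bands s d" using sd by (auto simp: bands_def abs_if split: if_splits)
    moreover have "floquet_u s d (of_real p) = -1"
      using floquet_u_p 3 \<beta> by (simp add: power2_eq_square field_simps)
    ultimately have "w_sq s d (of_real p) = -1" by (rule w_sq_band_edge[OF sd])
    thus ?thesis using 3 \<beta> by (simp add: epsilon_def power_int_minus)
  qed
qed

section \<open>Comparison of constants and the Green function uniformly in z\<close>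

lemma K2_ge: "4 * d\<^sup>2 / (\<alpha> * \<beta>\<^sup>2) \<le> K2 s d"
proof -
  define e where "e = d - s"
  define f where "f = sqrt (d\<^sup>2 - s\<^sup>2)"
  have e: "e > 0" "e \<le> d" using sd by (auto simp: e_def)
  have gap: "d\<^sup>2 - s\<^sup>2 = e * (d + s)" by (simp add: e_def power2_eq_square algebra_simps)
  have gap_pos: "d\<^sup>2 - s\<^sup>2 > 0" unfolding gap using e sd by simp
  have f: "f > 0" "f\<^sup>2 = d\<^sup>2 - s\<^sup>2" using gap_pos by (auto simp: f_def)
  have fe: "e \<le> f"
  proof (rule power2_le_imp_le)
    have "e * e \<le> e * (d + s)" using e sd by (intro mult_left_mono) (auto simp: e_def)
    thus "e\<^sup>2 \<le> f\<^sup>2" unfolding f gap by (simp add: power2_eq_square)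
  qed (use f in simp)
  \<comment> \<open>For x = \<alpha> + \<beta> and y = |\<alpha> - \<beta>| the relations give x^2 -
    y^2 = d^2 - s^2 with x \<le> d and y \<le> s. So x + y \<le> d + s forces x - y \<ge> d - s,
    while x - y is twice the smaller of \<alpha> and \<beta>.\<close>
  have \<beta>_ge: "e / 2 \<le> \<beta>"
  proof -
    define x where "x = \<alpha> + \<beta>"
    define y where "y = \<bar>\<alpha> - \<beta>\<bar>"
    have "x \<le> d" unfolding x_def by (rule \<alpha>\<beta>_le)
    moreover have "y \<le> s" unfolding y_def by (rule power2_le_imp_le) (use s_sq sd in auto)
    moreover have "y \<le> x" "x > 0" "y \<ge> 0" using \<alpha> \<beta> by (auto simp: x_def y_def)
    moreover have "(x - y) * (x + y) = e * (d + s)"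
      unfolding gap[symmetric] gap_eq x_def y_def
      by (simp add: power2_eq_square algebra_simps flip: power2_abs)
    ultimately have "e * (d + s) \<le> (x - y) * (d + s)"
      by (metis add_mono diff_ge_0_iff_ge mult_left_mono)
    hence "e \<le> x - y" using sd by simp
    also have "x - y \<le> 2 * \<beta>" by (simp add: x_def y_def)
    finally show ?thesis by simp
  qed
  have ab: "\<alpha> * \<beta> = f\<^sup>2 / 4" using gap_eq f by simp
  have "4 * d\<^sup>2 / (\<alpha> * \<beta>\<^sup>2) = 4 * d\<^sup>2 / (f\<^sup>2 / 4 * \<beta>)"
    unfolding ab[symmetric] by (simp add: power2_eq_square mult_ac)
  also have "\<dots> \<le> 4 * d\<^sup>2 / (f\<^sup>2 / 4 * (e / 2))"
    using \<beta>_ge f(1) e by (intro divide_left_mono mult_left_mono) auto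
  also have "\<dots> = 32 * d\<^sup>2 / (f\<^sup>2 * e)" by simp
  \<comment> \<open>The powers match through e^4 \<le> d^3 f; the numerical factor leaves room to
    spare, with 32 against 1024 sqrt 2.\<close>
  also have "\<dots> \<le> 1024 * sqrt 2 * d ^ 5 / (e ^ 5 * f)"
  proof -
    have ef: "e ^ 3 * e \<le> d ^ 3 * f" using e fe by (intro mult_mono power_mono) auto
    have "32 * (e ^ 3 * e) * (d\<^sup>2 * e * f) \<le> (32 * sqrt 2 * 32) * (d ^ 3 * f) * (d\<^sup>2 * e * f)"
    proof (rule mult_right_mono[OF mult_mono[OF _ ef]])
      have "1 \<le> sqrt 2" by simp
      thus "32 \<le> 32 * sqrt 2 * 32" by linarith
    qed (use e f in auto)
    hence cross: "32 * d\<^sup>2 * (e ^ 5 * f) \<le> 1024 * sqrt 2 * d ^ 5 * (f\<^sup>2 * e)"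
      by (simp add: power_numeral_reduce mult_ac)
    have pos: "f\<^sup>2 * e > 0" "e ^ 5 * f > 0" using e f(1) by simp_all
    show ?thesis
      by (rule mult_imp_div_pos_le[OF pos(1)], unfold times_divide_eq_left)
        (rule mult_imp_le_div_pos[OF pos(2) cross])
  qed
  also have "\<dots> = K2 s d" by (simp add: K2_def e_def f_def)
  finally show ?thesis .
qed

lemma green_pair_two_band:
  fixes z \<zeta> :: complex
  assumes m: "multiplier z \<zeta>" and \<zeta>: "cmod \<zeta> < 1" and ne: "of_real \<alpha> + of_real \<beta> * \<zeta> \<noteq> 0"
  shows "green_pair (\<lambda>n. of_real (a0 n)) (\<lambda>n. of_real (b0 n)) z (phi z \<zeta>) (psi z \<zeta>)
           (- (of_real \<beta> * (of_real \<alpha> + of_real \<beta> * \<zeta>)))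
           (2 * (2 * d\<^sup>2 / \<alpha>) * sqrt (cmod \<zeta>) / cmod (1 - \<zeta>\<^sup>2)) (sqrt (cmod \<zeta>))"
proof -
  define \<rho> where "\<rho> = sqrt (cmod \<zeta>)"
  have d: "d > 0" using sd by simp
  have \<rho>: "0 \<le> \<rho>" "\<rho> \<le> 1" "\<rho>\<^sup>2 = cmod \<zeta>" using \<zeta> by (auto simp: \<rho>_def)
  have lin: "cmod (of_real x + of_real y * \<zeta>) \<le> x + y" if "x > 0" "y > 0" for x y
  proof -
    have "cmod (of_real x + of_real y * \<zeta>) \<le> x + y * cmod \<zeta>"
      using that by (intro order_trans[OF norm_triangle_ineq]) (simp add: norm_mult)
    also have "\<dots> \<le> x + y * 1" using that \<zeta> by (intro add_left_mono mult_left_mono) auto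
    finally show ?thesis by simp
  qed
  have prod: "cmod (z - of_real p) * cmod (z - of_real r) * cmod \<zeta> \<le> (\<alpha> + \<beta>) * (\<alpha> + \<beta>)"
  proof -
    have "cmod (z - of_real p) * cmod (z - of_real r) * cmod \<zeta>
        = cmod (of_real \<alpha> + of_real \<beta> * \<zeta>) * cmod (of_real \<beta> + of_real \<alpha> * \<zeta>)"
      using multiplier_key[OF m] by (metis norm_mult)
    also have "\<dots> \<le> (\<alpha> + \<beta>) * (\<beta> + \<alpha>)" using \<alpha> \<beta> by (intro mult_mono lin) auto
    finally show ?thesis by (simp add: add.commute)
  qed
  \<comment> \<open>Since r = -p, z^2 \<zeta> differs from (z - p) (z - r) \<zeta> only by p^2
    \<zeta>, and the resulting bound (\<alpha> + \<beta>)^2 + p^2 is exactly d^2.\<close>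
  have z: "cmod z * \<rho> \<le> d"
  proof (rule power2_le_imp_le)
    have "z\<^sup>2 * \<zeta> = (z - of_real p) * (z - of_real r) * \<zeta> + of_real (p\<^sup>2) * \<zeta>"
      by (simp add: r_eq power2_eq_square algebra_simps)
    hence "cmod (z\<^sup>2 * \<zeta>) \<le> cmod ((z - of_real p) * (z - of_real r) * \<zeta>) + cmod (of_real (p\<^sup>2) * \<zeta>)"
      by (metis norm_triangle_ineq)
    also have "\<dots> \<le> (\<alpha> + \<beta>) * (\<alpha> + \<beta>) + p\<^sup>2 * 1"
      using prod \<zeta> by (intro add_mono) (auto simp: norm_mult norm_power intro!: mult_left_le)
    also have "\<dots> = d\<^sup>2" unfolding d_sq by (simp add: power2_eq_square)
    finally show "(cmod z * \<rho>)\<^sup>2 \<le> d\<^sup>2"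
      by (simp add: norm_mult norm_power power_mult_distrib \<rho>)
  qed (use d in simp)
  have shift: "cmod (z - of_real x) * \<rho> \<le> 2 * d" if "\<bar>x\<bar> \<le> d" for x
  proof -
    have "cmod (z - of_real x) * \<rho> \<le> (cmod z + \<bar>x\<bar>) * \<rho>"
      using \<rho> by (intro mult_right_mono order_trans[OF norm_triangle_ineq4]) auto
    also have "\<dots> = cmod z * \<rho> + \<bar>x\<bar> * \<rho>" by (simp add: algebra_simps)
    also have "\<dots> \<le> d + d * 1" using that \<rho> z by (intro add_mono mult_mono) auto
    finally show ?thesis by simp
  qed
  have \<alpha>M: "\<alpha> * (2 * d\<^sup>2 / \<alpha>) = 2 * d * d" using \<alpha> by (simp add: power2_eq_square)
  show ?thesis
  proof (rule green_pair_phi_psi[OF m \<zeta> ne])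
    have "cmod (z - of_real p) * \<rho> * cmod (of_real \<alpha> + of_real \<beta> * \<zeta>) \<le> 2 * d * d"
      using lin[OF \<alpha> \<beta>] \<alpha>\<beta>_le \<rho> d by (intro mult_mono shift p_le) auto
    thus "cmod (z - of_real p) * cmod (of_real \<alpha> + of_real \<beta> * \<zeta>) * sqrt (cmod \<zeta>) \<le> \<alpha> * (2 * d\<^sup>2 / \<alpha>)"
      unfolding \<alpha>M \<rho>_def by (simp add: mult_ac)
    have "(\<alpha> + \<beta>) * (cmod (z - of_real r) * \<rho>) \<le> d * (2 * d)"
      using \<alpha>\<beta>_le \<rho> d p_le by (intro mult_mono shift) (auto simp: r_eq)
    thus "(\<alpha> + \<beta>) * cmod (z - of_real r) * sqrt (cmod \<zeta>) \<le> \<alpha> * (2 * d\<^sup>2 / \<alpha>)"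
      unfolding \<alpha>M \<rho>_def by (simp add: mult_ac)
    have dd: "(\<alpha> + \<beta>) * (\<alpha> + \<beta>) \<le> d * d" using \<alpha>\<beta>_le \<alpha> \<beta> d by (intro mult_mono) auto
    have "d * d \<le> 2 * d * d" using d by simp
    thus "cmod (z - of_real p) * cmod (z - of_real r) * cmod \<zeta> \<le> \<alpha> * (2 * d\<^sup>2 / \<alpha>)"
      unfolding \<alpha>M using prod dd by linarith
    have "(\<alpha> + \<beta>) * cmod (of_real \<alpha> + of_real \<beta> * \<zeta>) \<le> (\<alpha> + \<beta>) * (\<alpha> + \<beta>)"
      using \<alpha> \<beta> by (intro mult_left_mono lin) auto
    thus "(\<alpha> + \<beta>) * cmod (of_real \<alpha> + of_real \<beta> * \<zeta>) \<le> \<alpha> * (2 * d\<^sup>2 / \<alpha>)"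
      unfolding \<alpha>M using dd \<open>d * d \<le> 2 * d * d\<close> by linarith
  qed
qed

end

section \<open>Perturbation\<close>

context periodic_jacobi
begin

lemma a0_ge: "min \<alpha> \<beta> \<le> a0 n" and a0_le: "a0 n \<le> \<alpha> + \<beta>"
  using a0_even[of "n div 2"] a0_odd[of "n div 2"] \<alpha> \<beta> by (cases "even n"; simp)+

lemma a0_pos: "a0 n > 0"
  using a0_ge[of n] \<alpha> \<beta> by linarith

definition gauge :: "(nat \<Rightarrow> complex) \<Rightarrow> nat \<Rightarrow> complex" where
  "gauge c n = (\<Prod>j\<in>{1..<n}. c j / of_real (a0 j))"

lemma gauge_Suc: "n \<ge> 1 \<Longrightarrow> gauge c (Suc n) = gauge c n * (c n / of_real (a0 n))"
  by (simp add: gauge_def)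

text \<open>
  The gauge turns the superdiagonal of \<open>J\<close> into that of \<open>J\<^sub>0\<close>, so that the perturbation
  involves only the products \<open>a\<^sub>n c\<^sub>n\<close>.
\<close>

lemma tau_gauge_bound:
  assumes J: "jacobi_operator a b c J" and y: "J y = z *\<^sub>C y"
    and c: "\<And>n. n \<ge> 1 \<Longrightarrow> c n \<noteq> 0" and m: "m \<ge> 1"
  defines "v \<equiv> \<lambda>n. gauge c n * coord y n"
  shows "cmod (tau z v m) \<le> perturbation_size a0 b0 a b c m * max (cmod (v m)) (cmod (v (m - 1)))"
proof -
  define A where "A = a (m - 1) * c (m - 1) / of_real (a0 (m - 1))"
  have ev: "a (m - 1) * coord y (m - 1) + b m * coord y m + c m * coord y (m + 1) = z * coord y m"
    using J m y unfolding jacobi_operator_def by (metis coord_scaleC)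
  have lower: "A * v (m - 1) = gauge c m * (a (m - 1) * coord y (m - 1))"
  \<comment> \<open>In the first row both sides are 0 because y vanishes at 0; the step formula for
    the gauge starts at index 1.\<close>
  proof (cases "m = 1")
    case True
    thus ?thesis by (simp add: v_def)
  next
    case False
    hence "gauge c m = gauge c (m - 1) * (c (m - 1) / of_real (a0 (m - 1)))"
      using m gauge_Suc[of "m - 1" c] by simp
    thus ?thesis by (simp add: v_def A_def)
  qed
  have upper: "of_real (a0 m) * v (m + 1) = gauge c m * (c m * coord y (m + 1))"
    using gauge_Suc[OF m, of c] a0_pos[of m] by (simp add: v_def)
  have "A * v (m - 1) + b m * v m + of_real (a0 m) * v (m + 1)
      = gauge c m * (a (m - 1) * coord y (m - 1) + b m * coord y m + c m * coord y (m + 1))"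
    unfolding lower upper by (simp add: v_def algebra_simps)
  also have "\<dots> = z * v m" unfolding ev by (simp add: v_def)
  finally have "tau z v m = (of_real (b0 m) - b m) * v m + (of_real (a0 (m - 1)) - A) * v (m - 1)"
    unfolding tau_def three_term_def by algebra
  hence "cmod (tau z v m) \<le> cmod (of_real (b0 m) - b m) * cmod (v m)
      + cmod (of_real (a0 (m - 1)) - A) * cmod (v (m - 1))"
    by (metis norm_mult norm_triangle_ineq)
  also have "\<dots> \<le> cmod (of_real (b0 m) - b m) * max (cmod (v m)) (cmod (v (m - 1)))
      + cmod (of_real (a0 (m - 1)) - A) * max (cmod (v m)) (cmod (v (m - 1)))"
    by (intro add_mono mult_left_mono) auto
  also have "\<dots> = perturbation_size a0 b0 a b c m * max (cmod (v m)) (cmod (v (m - 1)))"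
    by (simp add: perturbation_size_def A_def algebra_simps)
  finally show ?thesis .
qed

text \<open>Once |c_n - a_n| is small compared with 1/q - 1, each further factor of the product is
  at most 1/q in modulus, so the weighted gauge is eventually nonincreasing.\<close>

lemma gauge_subexponential:
  assumes lim: "(\<lambda>n. c n - of_real (a0 n)) \<longlonglongrightarrow> 0" and q: "0 < q" "q < 1"
  shows "\<exists>K. \<forall>n. cmod (gauge c n) * q ^ n \<le> K"
proof -
  define H where "H = (\<lambda>n. cmod (gauge c n) * q ^ n)"
  have H0: "H n \<ge> 0" for n using q by (simp add: H_def)
  \<comment> \<open>Chosen so that |c_n - a_n| < e implies |c_n| \<le> a_n / q for either parity of
    n.\<close>
  define e where "e = min \<alpha> \<beta> * (1 / q - 1)"
  have e: "e > 0" unfolding e_def using \<alpha> \<beta> q by (intro mult_pos_pos) auto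
  obtain N where N: "\<And>n. n \<ge> N \<Longrightarrow> cmod (c n - of_real (a0 n)) < e"
    using lim e by (auto simp: lim_sequentially dist_norm)
  have dec: "H (Suc n) \<le> H n" if "n \<ge> max N 1" for n
  proof -
    have "cmod (c n) \<le> cmod (of_real (a0 n)) + cmod (c n - of_real (a0 n))"
      by (metis add.commute diff_add_cancel norm_triangle_ineq)
    also have "\<dots> \<le> a0 n + a0 n * (1 / q - 1)"
    proof -
      have "e \<le> a0 n * (1 / q - 1)"
        unfolding e_def using q a0_ge by (intro mult_right_mono) auto
      thus ?thesis using N[of n] that a0_pos[of n] by simp
    qed
    also have "\<dots> = a0 n / q" using q by (simp add: field_simps)
    finally have "cmod (c n) / a0 n * q \<le> 1"
      using q a0_pos[of n] by (simp add: field_simps)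
    hence "H n * (cmod (c n) / a0 n * q) \<le> H n * 1"
      by (intro mult_left_mono H0)
    moreover have "H (Suc n) = H n * (cmod (c n) / a0 n * q)"
      using gauge_Suc[of n c] that a0_pos[of n] by (simp add: H_def norm_mult norm_divide)
    ultimately show ?thesis by simp
  qed
  define M where "M = max N 1"
  have tail: "H n \<le> H M" if "n \<ge> M" for n
    using that by (induction n rule: dec_induct) (use dec in \<open>auto simp: M_def intro: order_trans\<close>)
  have "H n \<le> (\<Sum>i\<le>M. H i)" for n
  proof (cases "n \<le> M")
    case True
    thus ?thesis using H0 by (intro member_le_sum) auto
  next
    case False
    hence "H n \<le> H M" using tail by simp
    also have "\<dots> \<le> (\<Sum>i\<le>M. H i)" using H0 by (intro member_le_sum) auto
    finally show ?thesis .
  qed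
  thus ?thesis unfolding H_def by blast
qed

end

lemma (in two_band_jacobi) no_eigenvalue_of_small_perturbation:
  fixes z :: complex
  assumes J0: "free_operator J0" and J: "jacobi_operator a b c J"
    and K: "compact_operator (\<lambda>y. J y - J0 y)"
    and nonzero: "\<And>n. n \<ge> 1 \<Longrightarrow> c n \<noteq> 0"
    and summable: "summable (\<lambda>m. perturbation_size a0 b0 a b c (Suc m))"
    and m: "multiplier z \<zeta>" and \<zeta>: "cmod \<zeta> < 1" and ne: "of_real \<alpha> + of_real \<beta> * \<zeta> \<noteq> 0"
    and small: "4 * d\<^sup>2 * sqrt (cmod \<zeta>) / (\<alpha> * cmod (1 - \<zeta>\<^sup>2))
        * (\<Sum>m. perturbation_size a0 b0 a b c (Suc m)) < \<beta> * cmod (of_real \<alpha> + of_real \<beta> * \<zeta>)"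
  shows "\<not> is_eigenvalue J z"
proof
  assume "is_eigenvalue J z"
  then obtain y where y: "y \<noteq> 0" "J y = z *\<^sub>C y" by (auto simp: is_eigenvalue_def)
  define v where "v = (\<lambda>n. gauge c n * coord y n)"
  define \<rho> where "\<rho> = sqrt (cmod \<zeta>)"
  \<comment> \<open>Any weight strictly between \<rho> and 1 works: above \<rho> for the Green
    function, below 1 to absorb the growth of the gauge.\<close>
  define q where "q = (\<rho> + 1) / 2"
  have \<rho>: "0 \<le> \<rho>" "\<rho> < 1" using \<zeta> by (auto simp: \<rho>_def)
  have q: "\<rho> < q" "q < 1" "0 < q" using \<rho> by (auto simp: q_def)
  have "(\<lambda>n. c n - of_real (a0 n)) \<longlonglongrightarrow> 0"
    using compact_jacobi_difference[OF J0[unfolded free_operator_def] J K] .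
  then obtain G where G: "\<And>n. cmod (gauge c n) * q ^ n \<le> G"
    using gauge_subexponential q by blast
  have v_bound: "cmod (v n) * q ^ n \<le> G * norm y" for n
  proof -
    have "cmod (v n) * q ^ n = (cmod (gauge c n) * q ^ n) * cmod (coord y n)"
      by (simp add: v_def norm_mult)
    also have "\<dots> \<le> G * norm y"
      using G[of n] order_trans[OF _ G[of 0]] by (intro mult_mono cmod_coord_le_norm) auto
    finally show ?thesis .
  qed
  have v: "v n = 0" for n
  proof (rule green_pair.trivial_if_small_perturbation[OF green_pair_two_band[OF m \<zeta> ne],
        where v = v and q = q and \<delta> = "perturbation_size a0 b0 a b c"])
    show "v 0 = 0" by (simp add: v_def)
    show "cmod (complex_of_real (a0 n)) \<le> \<alpha> + \<beta>" for n
      using a0_le[of n] a0_pos[of n] by simp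
    show "cmod (three_term (\<lambda>n. of_real (a0 n)) (\<lambda>n. of_real (b0 n)) z v k)
        \<le> perturbation_size a0 b0 a b c k * max (cmod (v k)) (cmod (v (k - 1)))" if "k \<ge> 1" for k
      using tau_gauge_bound[OF J y(2) nonzero that] unfolding tau_def v_def .
    show "0 \<le> perturbation_size a0 b0 a b c k" for k by (simp add: perturbation_size_def)
    show "2 * (2 * d\<^sup>2 / \<alpha>) * sqrt (cmod \<zeta>) / cmod (1 - \<zeta>\<^sup>2)
        * (\<Sum>m. perturbation_size a0 b0 a b c (Suc m))
        < cmod (- (complex_of_real \<beta> * (of_real \<alpha> + of_real \<beta> * \<zeta>)))"
      using small \<beta> by (simp add: norm_mult)
  qed (use q v_bound summable in \<open>auto simp: \<rho>_def\<close>)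
  have "gauge c n \<noteq> 0" for n
    unfolding gauge_def using nonzero a0_pos by (auto simp: less_imp_neq[symmetric])
  hence "y = 0" using v by (intro ell2_eqI) (simp add: v_def)
  thus False using y by simp
qed

theorem theorem1p1:
  fixes s d t :: real
    and a0 b0 :: "nat \<Rightarrow> real"
    and a b c :: "nat \<Rightarrow> complex"
    and J0 J :: "ell2 \<Rightarrow> ell2"
  assumes sd: "0 < s" "s < d"
    and periodic_a: "\<And>n. n \<ge> 1 \<Longrightarrow> a0 (n + 2) = a0 n"
    and periodic_b: "\<And>n. n \<ge> 1 \<Longrightarrow> b0 (n + 2) = b0 n"
    and positive: "\<And>n. n \<ge> 1 \<Longrightarrow> a0 n > 0"
    and a0_zero: "a0 0 = a0 2"
    and J0: "jacobi_operator (\<lambda>n. complex_of_real (a0 n)) (\<lambda>n. complex_of_real (b0 n))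
               (\<lambda>n. complex_of_real (a0 n)) J0"
    and spectrum: "continuous_spectrum J0 = bands s d"
    and nonzero: "\<And>n. n \<ge> 1 \<Longrightarrow> a n * c n \<noteq> 0"
    and ac_zero: "a 0 = complex_of_real (a0 0)" "c 0 = complex_of_real (a0 0)"
    and J: "jacobi_operator a b c J"
    and compact: "compact_operator (\<lambda>y. J y - J0 y)"
    and summable: "summable (\<lambda>m. perturbation_size a0 b0 a b c (Suc m))"
    and t: "t > 0" "t * exp t = 1"
  shows "{z. let w2 = w_sq s d z;
                 D = cmod (w2 - w_sq s d (complex_of_real (b0 1)) powi epsilon J0 s)
                     * cmod (1 - w2\<^sup>2)
             in D \<noteq> 0 \<and>
                K2 s d * sqrt (cmod w2) / D
                  * (\<Sum>m. perturbation_size a0 b0 a b c (Suc m)) < t}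
         \<inter> discrete_spectrum J J0 = {}"
proof -
  interpret periodic_jacobi a0 b0
    by unfold_locales (fact periodic_a periodic_b positive a0_zero)+
  have free: "free_operator J0" using J0 by (simp add: free_operator_def)
  interpret two_band_jacobi a0 b0 s d
    by unfold_locales (fact sd band_edges[OF free sd spectrum])+
  define P where "P = (\<Sum>m. perturbation_size a0 b0 a b c (Suc m))"
  have P: "P \<ge> 0"
    unfolding P_def using summable by (intro suminf_nonneg) (auto simp: perturbation_size_def)
  have t1: "t < 1"
  proof (rule ccontr)
    assume "\<not> t < 1"
    hence "1 * 1 < t * exp t" using t(1) by (intro mult_le_less_imp_less) auto
    thus False using t(2) by simp
  qed
  \<comment> \<open>The discrete spectrum avoids the bands, so z has a genuine small root; a
    boundary value of w^2 can only enter through \<nu>.\<close>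
  have "\<not> is_eigenvalue J z"
    if z: "z \<notin> bands s d" and D0: "D \<noteq> 0" and small: "K2 s d * sqrt (cmod (w_sq s d z)) / D * P < t"
      and D: "D = cmod (w_sq s d z - w_sq s d (complex_of_real (b0 1)) powi epsilon J0 s)
                     * cmod (1 - (w_sq s d z)\<^sup>2)" for z D
  proof -
    define \<zeta> where "\<zeta> = w_sq s d z"
    have "\<zeta> = small_root s d z" using z by (simp add: \<zeta>_def w_sq_def)
    note \<zeta> = small_root_props[OF sd z, folded this]
    define X where "X = cmod (\<zeta> + of_real (\<alpha> / \<beta>))"
    define Y where "Y = cmod (1 - \<zeta>\<^sup>2)"
    have D_eq: "D = X * Y"
      using D unfolding w_sq_p_powi[OF free] by (simp add: X_def Y_def \<zeta>_def)
    have XY: "X > 0" "Y > 0" using D0 unfolding D_eq by (auto simp: X_def Y_def)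
    have lin: "of_real \<alpha> + of_real \<beta> * \<zeta> = of_real \<beta> * (\<zeta> + of_real (\<alpha> / \<beta>))"
      using \<beta> by (simp add: field_simps)
    have linX: "cmod (of_real \<alpha> + of_real \<beta> * \<zeta>) = \<beta> * X"
      unfolding lin norm_mult X_def using \<beta> by simp
    define \<rho> where "\<rho> = sqrt (cmod \<zeta>)"
    have \<rho>: "\<rho> \<ge> 0" by (simp add: \<rho>_def)
    \<comment> \<open>The Wronskian has modulus \<beta>^2 X, which is where \<beta>^2 in the
      constant comes from; multiplying by it gives the contraction condition.\<close>
    have "4 * d\<^sup>2 / (\<alpha> * \<beta>\<^sup>2) * (\<rho> / (X * Y) * P) \<le> K2 s d * (\<rho> / (X * Y) * P)"
      using XY P \<rho> by (intro mult_right_mono K2_ge) auto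
    also have "\<dots> < 1" using small t1 by (simp add: D_eq \<rho>_def \<zeta>_def)
    finally have "4 * d\<^sup>2 / (\<alpha> * \<beta>\<^sup>2) * (\<rho> / (X * Y) * P) * (\<beta>\<^sup>2 * X) < 1 * (\<beta>\<^sup>2 * X)"
      using XY \<beta> by (intro mult_strict_right_mono) auto
    moreover have "4 * d\<^sup>2 / (\<alpha> * \<beta>\<^sup>2) * (\<rho> / (X * Y) * P) * (\<beta>\<^sup>2 * X) = 4 * d\<^sup>2 * \<rho> / (\<alpha> * Y) * P"
      using XY \<alpha> \<beta> by (simp add: field_simps)
    ultimately have "4 * d\<^sup>2 * \<rho> / (\<alpha> * Y) * P < \<beta> * (\<beta> * X)"
      by (simp add: power2_eq_square mult.assoc)
    moreover have "of_real \<alpha> + of_real \<beta> * \<zeta> \<noteq> 0" using linX XY \<beta> by auto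
    ultimately show ?thesis
      using nonzero unfolding P_def Y_def \<rho>_def linX[symmetric]
      by (intro no_eigenvalue_of_small_perturbation[OF free J compact _ summable
            multiplier_floquet[OF \<zeta>(1,3)] \<zeta>(2)]) auto
  qed
  thus ?thesis
    unfolding discrete_spectrum_def spectrum Let_def P_def[symmetric] by blast
qed

end
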